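(* Let $G$ be a finitely generated subgroup of the automorphism group of a locally finite rooted tree $T$. Consider the groupoid of germs $\mathfrak{G}$ of the action of $G$ on the boundary $\partial T$ of the tree, and let $S$ be an open compact generating set of $\mathfrak{G}$. If $\gamma_S(x,n)$ has sub-exponential growth (as a function of $n$) for every $x\in\partial T$, then $G$ has no non-abelian free subgroups.
   Context: Automorphisms of a rooted tree fix the root. The boundary $\partial T$ is the space of infinite simple paths starting at the root, with its natural topology (basic open sets: all paths through a given vertex); automorphisms of $T$ act on it by homeomorphisms. Groupoid of germs: a germ is an equivalence class of pairs $(g,x)\in G\times\partial T$, where $(g_1,x)$ and $(g_2,x)$ are equivalent if $g_1$ and $g_2$ coincide as maps on some neighborhood of $x$. The germs form a groupoid $\mathfrak{G}$ with multiplication $(g_2,g_1(x))(g_1,x)=(g_2g_1,x)$; the unit space is identified with $\partial T$ via $(1,x)\leftrightarrow x$, and the origin of $(g,x)$ is $x$. Its topology has as a basis the sets of germs $\{(g,x):x\in U\}$ for $g\in G$ and $U\subset\partial T$ open. An open compact set $S\subset\mathfrak{G}$ (compact sets need not be closed or Hausdorff) is a generating set of $\mathfrak{G}$ if $\mathfrak{G}=\bigcup_{n\ge 0}(S\cup S^{-1})^n$, the $0$-th power being the set of units. For example, the set of all germs of elements of a finite generating set of $G$ is such a set. For $x\in\partial T$, $\gamma_S(x,n)$ is the number of elements of $\mathfrak{G}$ with origin $x$ that can be written as products of at most $n$ elements of $S\cup S^{-1}$ (the unit $x$ being the empty product); equivalently, it is the number of vertices in the ball of radius $n$ centered at $x$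 in the Cayley graph whose vertices are the elements of $\mathfrak{G}$ with origin $x$, with an arrow from $g_1$ to $g_2$ whenever $g_2=sg_1$ for some $s\in S$. The growth rate of $\gamma_S(x,n)$ does not depend on the choice of $S$. Sub-exponential growth means $\lim_{n\to\infty}\frac1n\log\gamma_S(x,n)=0$.
   Formalization: The formal theorem also assumes that G acts faithfully on ∂T (automatic if every vertex lies on an infinite path from the root); without this it fails, e.g. for a free group acting faithfully only on leaves attached to a single ray. *)

theory Defs
  imports "HOL-Analysis.Analysis" "HOL-Algebra.Bij" "HOL-Algebra.Generated_Groups"
begin

subsection \<open>Locally finite rooted trees, their automorphisms and their boundary\<close>

text \<open>
  A tree is a simple graph (vertex set \<open>V\<close>, symmetric irreflexive adjacency relation \<open>adj\<close>)
  that is connected and has no cycles.  A cycle is the list of its pairwise distinct vertices,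
  of which there are at least three.
\<close>

locale rooted_tree =
  fixes V :: "'v set" and adj :: "'v \<Rightarrow> 'v \<Rightarrow> bool" and r :: 'v
  assumes adj_in_V: "adj u v \<Longrightarrow> u \<in> V \<and> v \<in> V"
    and adj_sym: "adj u v \<Longrightarrow> adj v u"
    and adj_irrefl: "\<not> adj u u"
    and root_in_V: "r \<in> V"
    and connected: "u \<in> V \<Longrightarrow> v \<in> V \<Longrightarrow> adj\<^sup>*\<^sup>* u v"
    and no_cycles:
      "\<not> (\<exists>c. 3 \<le> length c \<and> distinct c \<and> successively adj c \<and> adj (last c) (hd c))"

locale locally_finite_rooted_tree = rooted_tree V adj r
  for V :: "'v set" and adj :: "'v \<Rightarrow> 'v \<Rightarrow> bool" and r :: 'v +
  assumes locally_finite: "v \<in> V \<Longrightarrow> finite {w. adj v w}"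

definition tree_aut :: "'v set \<Rightarrow> ('v \<Rightarrow> 'v \<Rightarrow> bool) \<Rightarrow> 'v \<Rightarrow> ('v \<Rightarrow> 'v) monoid" where
  "tree_aut V adj r = (BijGroup V)
     \<lparr>carrier := {g \<in> Bij V. g r = r \<and> (\<forall>u\<in>V. \<forall>v\<in>V. adj (g u) (g v) \<longleftrightarrow> adj u v)}\<rparr>"

text \<open>
  A boundary point is an infinite simple path starting at the root.  An automorphism \<open>g\<close> sends
  the path \<open>x\<close> to the path \<open>g \<circ> x\<close>.
\<close>

definition boundary :: "('v \<Rightarrow> 'v \<Rightarrow> bool) \<Rightarrow> 'v \<Rightarrow> (nat \<Rightarrow> 'v) set" where
  "boundary adj r = {x. x 0 = r \<and> (\<forall>n. adj (x n) (x (Suc n))) \<and> inj x}"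

definition boundary_topology ::
    "'v set \<Rightarrow> ('v \<Rightarrow> 'v \<Rightarrow> bool) \<Rightarrow> 'v \<Rightarrow> (nat \<Rightarrow> 'v) topology" where
  "boundary_topology V adj r =
     topology_generated_by {{x \<in> boundary adj r. v \<in> range x} | v. v \<in> V}"

subsection \<open>The groupoid of germs of an action\<close>

text \<open>
  In this section a group \<open>G\<close> acts by homeomorphisms on the space \<open>M\<close>; the action of \<open>g\<close> on
  the point \<open>x\<close> is \<open>act g x\<close>.
\<close>

definition germ_rel ::
    "('g, 'm) monoid_scheme \<Rightarrow> 'x topology \<Rightarrow> ('g \<Rightarrow> 'x \<Rightarrow> 'x) \<Rightarrow> ('g \<times> 'x) rel" where
  "germ_rel G M act =
     {((g1, x), (g2, x)) | g1 g2 x. g1 \<in> carrier G \<and> g2 \<in> carrier G \<and> x \<in> topspace M \<and>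
        (\<exists>U. openin M U \<and> x \<in> U \<and> (\<forall>y\<in>U. act g1 y = act g2 y))}"

definition germ ::
    "('g, 'm) monoid_scheme \<Rightarrow> 'x topology \<Rightarrow> ('g \<Rightarrow> 'x \<Rightarrow> 'x) \<Rightarrow> 'g \<Rightarrow> 'x \<Rightarrow> ('g \<times> 'x) set" where
  "germ G M act g x = germ_rel G M act `` {(g, x)}"

definition germs ::
    "('g, 'm) monoid_scheme \<Rightarrow> 'x topology \<Rightarrow> ('g \<Rightarrow> 'x \<Rightarrow> 'x) \<Rightarrow> ('g \<times> 'x) set set" where
  "germs G M act = (carrier G \<times> topspace M) // germ_rel G M act"

definition germ_topology ::
    "('g, 'm) monoid_scheme \<Rightarrow> 'x topology \<Rightarrow> ('g \<Rightarrow> 'x \<Rightarrow> 'x) \<Rightarrow> ('g \<times> 'x) set topology" where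
  "germ_topology G M act =
     topology_generated_by {germ G M act g ` U | g U. g \<in> carrier G \<and> openin M U}"

definition germ_origin ::
    "('g, 'm) monoid_scheme \<Rightarrow> 'x topology \<Rightarrow> ('g \<Rightarrow> 'x \<Rightarrow> 'x) \<Rightarrow> 'x \<Rightarrow> ('g \<times> 'x) set set" where
  "germ_origin G M act x = {germ G M act g x | g. g \<in> carrier G}"

definition germ_units ::
    "('g, 'm) monoid_scheme \<Rightarrow> 'x topology \<Rightarrow> ('g \<Rightarrow> 'x \<Rightarrow> 'x) \<Rightarrow> ('g \<times> 'x) set set" where
  "germ_units G M act = {germ G M act \<one>\<^bsub>G\<^esub> x | x. x \<in> topspace M}"

text \<open>
  The multiplication of the groupoid is partial; it is given here on sets of germs, as the set
  \<open>A B\<close> of all products that are defined and have a left factor in \<open>A\<close> and a right one in \<open>B\<close>.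
\<close>

definition germ_mult ::
    "('g, 'm) monoid_scheme \<Rightarrow> 'x topology \<Rightarrow> ('g \<Rightarrow> 'x \<Rightarrow> 'x) \<Rightarrow>
     ('g \<times> 'x) set set \<Rightarrow> ('g \<times> 'x) set set \<Rightarrow> ('g \<times> 'x) set set" where
  "germ_mult G M act A B =
     {germ G M act (g2 \<otimes>\<^bsub>G\<^esub> g1) x | g2 g1 x.
        g2 \<in> carrier G \<and> g1 \<in> carrier G \<and> x \<in> topspace M \<and>
        germ G M act g2 (act g1 x) \<in> A \<and> germ G M act g1 x \<in> B}"

definition germ_inv ::
    "('g, 'm) monoid_scheme \<Rightarrow> 'x topology \<Rightarrow> ('g \<Rightarrow> 'x \<Rightarrow> 'x) \<Rightarrow>
     ('g \<times> 'x) set set \<Rightarrow> ('g \<times> 'x) set set" where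
  "germ_inv G M act A =
     {germ G M act (inv\<^bsub>G\<^esub> g) (act g x) | g x.
        g \<in> carrier G \<and> x \<in> topspace M \<and> germ G M act g x \<in> A}"

primrec germ_power ::
    "('g, 'm) monoid_scheme \<Rightarrow> 'x topology \<Rightarrow> ('g \<Rightarrow> 'x \<Rightarrow> 'x) \<Rightarrow>
     ('g \<times> 'x) set set \<Rightarrow> nat \<Rightarrow> ('g \<times> 'x) set set" where
  "germ_power G M act A 0 = germ_units G M act"
| "germ_power G M act A (Suc n) = germ_mult G M act A (germ_power G M act A n)"

definition open_compact_generating ::
    "('g, 'm) monoid_scheme \<Rightarrow> 'x topology \<Rightarrow> ('g \<Rightarrow> 'x \<Rightarrow> 'x) \<Rightarrow> ('g \<times> 'x) set set \<Rightarrow> bool" where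
  "open_compact_generating G M act S \<longleftrightarrow>
     openin (germ_topology G M act) S \<and> compactin (germ_topology G M act) S \<and>
     germs G M act = (\<Union>n. germ_power G M act (S \<union> germ_inv G M act S) n)"

definition germ_growth ::
    "('g, 'm) monoid_scheme \<Rightarrow> 'x topology \<Rightarrow> ('g \<Rightarrow> 'x \<Rightarrow> 'x) \<Rightarrow>
     ('g \<times> 'x) set set \<Rightarrow> 'x \<Rightarrow> nat \<Rightarrow> nat" where
  "germ_growth G M act S x n =
     card (germ_origin G M act x \<inter>
           (\<Union>k\<le>n. germ_power G M act (S \<union> germ_inv G M act S) k))"

definition subexponential_growth :: "(nat \<Rightarrow> nat) \<Rightarrow> bool" where
  "subexponential_growth f \<longleftrightarrow> (\<lambda>n. 1 / real n * ln (real (f n))) \<longlonglongrightarrow> 0"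

subsection \<open>Free groups\<close>

text \<open>
  A word over \<open>B\<close> is a list of letters \<open>(b, e)\<close> with \<open>b \<in> B\<close>: the letter \<open>(b, True)\<close> stands for
  \<open>b\<close> and \<open>(b, False)\<close> for its inverse.  A group is free on the subset \<open>B\<close> if each of its
  elements is the value of exactly one reduced word over \<open>B\<close>.
\<close>

definition reduced_words :: "'g set \<Rightarrow> ('g \<times> bool) list set" where
  "reduced_words B =
     {w. fst ` set w \<subseteq> B \<and> successively (\<lambda>p q. \<not> (fst p = fst q \<and> snd p \<noteq> snd q)) w}"

definition word_value :: "('g, 'm) monoid_scheme \<Rightarrow> ('g \<times> bool) list \<Rightarrow> 'g" where
  "word_value G w = foldr (\<lambda>(b, e) a. (if e then b else inv\<^bsub>G\<^esub> b) \<otimes>\<^bsub>G\<^esub> a) w \<one>\<^bsub>G\<^esub>"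

definition free_group_on :: "('g, 'm) monoid_scheme \<Rightarrow> 'g set \<Rightarrow> bool" where
  "free_group_on G B \<longleftrightarrow>
     group G \<and> B \<subseteq> carrier G \<and> bij_betw (word_value G) (reduced_words B) (carrier G)"

definition is_free_group :: "('g, 'm) monoid_scheme \<Rightarrow> bool" where
  "is_free_group G \<longleftrightarrow> (\<exists>B. free_group_on G B)"

end

theory Submission
  imports Defs
begin

text \<open>
  Suppose that \<open>G\<close> contains a non-abelian free group \<open>F\<close>, and let \<open>L\<close> be the subgroup generated by two
  elements \<open>a \<noteq> b\<close> of its free basis.  The key point is that there is a boundary point \<open>x\<close> at which
  different elements of \<open>L\<close> have different germs.

  Otherwise each boundary point has a neighbourhood on which some nontrivial element of \<open>L\<close> is
  trivial.  The boundary is compact, so finitely many such neighbourhoods \<open>W\<^sub>i\<close> suffice, with elements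
  \<open>g\<^sub>i\<close>; they may be taken to consist of all paths through finitely many given vertices, and then there
  is \<open>n > 0\<close> such that the \<open>n\<close>-th power of every automorphism preserves all of them.  If \<open>g\<close> and \<open>h\<close>
  preserve these sets and are trivial on \<open>U\<close> and \<open>W\<close>, respectively, where \<open>U\<close> and \<open>W\<close> are unions of
  such sets, then the commutator of \<open>g\<close> and \<open>h\<close> is trivial on \<open>U \<union> W\<close>.
  Thus an iterated commutator of conjugates of the elements \<open>g\<^sub>i\<^sup>n\<close>, by \<open>n\<close>-th powers of elements of
  \<open>L\<close>, acts trivially on the whole boundary.  In a free group the conjugating elements can be chosen in
  such a way that this commutator is not \<open>1\<close>, and this contradicts the faithfulness of the action
  (\<open>exists_point_with_free_germs\<close>).

  Two facts about \<open>L\<close> enter: it is torsion free, and for nontrivial \<open>g\<close> and \<open>h\<close> and every \<open>k > 0\<close>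
  the element \<open>g\<close> fails to commute with one of the conjugates of \<open>h\<close> by \<open>1\<close>, \<open>a\<^sup>k\<close>, \<open>b\<^sup>k\<close>.  Both follow
  from Sanov's embedding of \<open>L\<close> into \<open>SL(2, \<int>)\<close>: the first by a look at the traces, the second because
  two matrices commute if and only if their traceless parts are parallel.

  Given \<open>x\<close>, compactness of the boundary yields \<open>N\<close> such that all germs of \<open>a\<close> and \<open>b\<close> are products of
  at most \<open>N\<close> elements of \<open>S \<union> S\<^sup>-\<^sup>1\<close>.  Already the \<open>2\<^sup>n\<close> positive words of length \<open>n\<close> in \<open>a\<close> and \<open>b\<close> give
  different germs at \<open>x\<close> in the ball of radius \<open>N n\<close>
  (\<open>free_semigroup_germs_imp_exponential_growth\<close>), so the growth at \<open>x\<close> is exponential.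
\<close>

section \<open>The Sanov representation of the free group of rank two\<close>

definition unipotent :: "bool \<Rightarrow> int \<Rightarrow> int^2^2" where
  "unipotent c m = (if c then vector [vector [1, m], vector [0, 1]]
                    else vector [vector [1, 0], vector [m, 1]])"

text \<open>
  The images of the two free generators (first component) and of their inverses (second component
  \<open>False\<close>) under Sanov's embedding of the free group of rank two into \<open>SL(2, \<int>)\<close>.
\<close>

definition sanov :: "bool \<times> bool \<Rightarrow> int^2^2" where
  "sanov s = unipotent (fst s) (if snd s then 2 else -2)"

definition sanov_word :: "(bool \<times> bool) list \<Rightarrow> int^2^2" where
  "sanov_word w = foldr (\<lambda>s P. sanov s ** P) w (mat 1)"

definition scalar :: "int^2^2 \<Rightarrow> bool" where
  "scalar P \<longleftrightarrow> P$1$2 = 0 \<and> P$2$1 = 0 \<and> P$1$1 = P$2$2"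

abbreviation no_cancel :: "'a \<times> bool \<Rightarrow> 'a \<times> bool \<Rightarrow> bool" where
  "no_cancel p q \<equiv> \<not> (fst p = fst q \<and> snd p \<noteq> snd q)"

text \<open>
  These four double cones in the plane are the ping-pong sets: a letter moves every cone, except the
  one of its inverse, into its own cone.  With \<open>p\<close> the coordinate that the letter changes and \<open>q\<close> the
  other one, up to the sign of the letter, the cone is given by \<open>0 < q / p < 1\<close>; spelling this out
  without division keeps the arithmetic linear.
\<close>

definition sanov_region :: "bool \<times> bool \<Rightarrow> (int^2) set" where
  "sanov_region s = {v. \<exists>p q. p = (if fst s then v$1 else v$2) \<and>
                            q = (if snd s then 1 else -1) * (if fst s then v$2 else v$1) \<and>
                            (0 < q \<and> q < p \<or> p < q \<and> q < 0)}"

lemmas matrix_2_simps = matrix_matrix_mult_def sum_2 vec_eq_iff forall_2 mat_def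

lemma unipotent_add: "unipotent c m ** unipotent c n = unipotent c (m + n)"
  by (cases c) (simp_all add: unipotent_def matrix_2_simps)

lemma unipotent_0: "unipotent c 0 = mat 1"
  by (cases c) (simp_all add: unipotent_def matrix_2_simps)

lemma sanov_cancel: "sanov (c, e) ** sanov (c, \<not> e) = mat 1"
  by (simp add: sanov_def unipotent_add unipotent_0)

lemma sanov_region_step:
  assumes "v \<in> sanov_region t" "no_cancel s t"
  shows "sanov s *v v \<in> sanov_region s"
proof -
  obtain c e c' e' where st: "s = (c, e)" "t = (c', e')" by (cases s; cases t)
  show ?thesis
    using assms unfolding st
    by (cases c; cases e; cases c'; cases e')
      (simp_all add: sanov_region_def sanov_def unipotent_def matrix_vector_mult_def sum_2,
       arith+)
qed

lemma sanov_word_Cons: "sanov_word (s # w) = sanov s ** sanov_word w"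
  by (simp add: sanov_word_def)

lemma sanov_word_append: "sanov_word (u @ v) = sanov_word u ** sanov_word v"
  by (induction u) (simp_all add: sanov_word_def matrix_mul_assoc)

lemma sanov_word_region:
  assumes "successively no_cancel w" "w \<noteq> []" "v \<in> sanov_region t" "no_cancel (last w) t"
  shows "sanov_word w *v v \<in> sanov_region (hd w)"
  using assms
proof (induction w)
  case (Cons s w)
  show ?case
  proof (cases "w = []")
    case True
    then show ?thesis
      using Cons.prems sanov_region_step[of v t s] by (simp add: sanov_word_def)
  next
    case False
    then have "sanov_word w *v v \<in> sanov_region (hd w)"
      using Cons by (simp add: successively_Cons)
    then show ?thesis
      using False Cons.prems sanov_region_step[of "sanov_word w *v v" "hd w" s]
      by (simp add: sanov_word_Cons matrix_vector_mul_assoc successively_Cons)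
  qed
qed simp

lemma sanov_region_nonempty: "\<exists>v. v \<in> sanov_region t"
proof -
  obtain c e where t: "t = (c, e)" by (cases t)
  have "vector [if c then 2 else 1, (if c then 1 else 2) * (if e then 1 else -1)] \<in> sanov_region t"
    by (cases c; cases e) (simp_all add: t sanov_region_def)
  then show ?thesis by blast
qed

text \<open>
  The cones are invariant under scaling, also by negative factors, and pairwise disjoint.  Hence a
  matrix that moves a point of one cone into another one is not scalar, which is stronger than not
  being the identity.
\<close>

lemma sanov_region_scale:
  assumes v: "v \<in> sanov_region s" and w: "w \<in> sanov_region t"
    and l: "w$1 = l * v$1" "w$2 = l * v$2"
  shows "s = t"
proof -
  obtain c e c' e' where st: "s = (c, e)" "t = (c', e')" by (cases s; cases t)
  define p q where
    "p = (if c then v$1 else v$2)" and "q = (if e then 1 else -1) * (if c then v$2 else v$1)"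
  then have pq: "0 < q \<and> q < p \<or> p < q \<and> q < 0"
    and pq': "l * p = (if c then w$1 else w$2)"
      "l * q = (if e then 1 else -1) * (if c then w$2 else w$1)"
    using v by (auto simp: sanov_region_def st l)
  have "l \<noteq> 0" using w l by (auto simp: sanov_region_def split: if_splits)
  then have "0 < l * q \<and> l * q < l * p \<or> l * p < l * q \<and> l * q < 0"
    using pq by (auto simp: mult_less_cancel_left zero_less_mult_iff mult_less_0_iff)
  then have "w \<in> sanov_region s"
    using pq' by (simp add: sanov_region_def st)
  with w show ?thesis
    unfolding st by (cases c; cases e; cases c'; cases e') (simp_all add: sanov_region_def, arith+)
qed

text \<open>
  Ping-pong: choose a cone that is neither the one of the first letter nor the one of the inverse of
  the last letter; there are four cones, so it exists.  The word moves it into the cone of its first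
  letter.
\<close>

lemma sanov_word_not_scalar:
  assumes "successively no_cancel w" "w \<noteq> []"
  shows "\<not> scalar (sanov_word w)"
proof
  assume sc: "scalar (sanov_word w)"
  obtain t where t: "t \<noteq> hd w" "no_cancel (last w) t"
  proof -
    have "\<exists>t::bool\<times>bool. t \<noteq> p \<and> no_cancel q t" for p q :: "bool \<times> bool"
      by (cases p; cases q) auto
    then show ?thesis using that by blast
  qed
  obtain v where v: "v \<in> sanov_region t" using sanov_region_nonempty by blast
  let ?l = "sanov_word w $1$1"
  have "(sanov_word w *v v)$1 = ?l * v$1" "(sanov_word w *v v)$2 = ?l * v$2"
    using sc by (simp_all add: scalar_def matrix_vector_mult_def sum_2)
  then have "t = hd w"
    using sanov_region_scale[OF v sanov_word_region[OF assms v t(2)]] by blast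
  then show False using t(1) by simp
qed

text \<open>
  This congruence forces the trace to be \<open>2\<close> modulo \<open>4\<close>, whereas a non-scalar matrix of finite order
  in \<open>SL(2, \<int>)\<close> has trace \<open>-1\<close>, \<open>0\<close> or \<open>1\<close>.  It therefore excludes torsion.
\<close>

lemma sanov_word_mod_4:
  "sanov_word w $1$1 mod 4 = 1 \<and> sanov_word w $2$2 mod 4 = 1 \<and>
   even (sanov_word w $1$2) \<and> even (sanov_word w $2$1)"
proof (induction w)
  case Nil
  then show ?case by (simp add: sanov_word_def mat_def)
next
  case (Cons s w)
  obtain c e where "s = (c, e)" by (cases s)
  with Cons show ?case
    by (cases c; cases e) (auto simp: sanov_word_Cons sanov_def unipotent_def matrix_2_simps, presburger+)
qed

lemma sanov_word_det:
  "sanov_word w $1$1 * sanov_word w $2$2 - sanov_word w $1$2 * sanov_word w $2$1 = 1"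
proof -
  have "det (sanov s) = 1" for s
    by (cases s; cases "fst s") (simp_all add: sanov_def unipotent_def det_2)
  then have "det (sanov_word w) = 1"
    by (induction w) (simp_all add: sanov_word_def det_mul)
  then show ?thesis by (simp add: det_2)
qed

lemma sanov_word_trace: "2 \<le> \<bar>sanov_word w $1$1 + sanov_word w $2$2\<bar>"
  using sanov_word_mod_4[of w] by presburger

text \<open>
  By the theorem of Cayley and Hamilton, \<open>P\<^sup>k = u\<^sub>k P - u\<^sub>k\<^sub>-\<^sub>1\<close> with \<open>u\<^sub>k\<^sub>+\<^sub>1 = t u\<^sub>k - u\<^sub>k\<^sub>-\<^sub>1\<close>, where \<open>t\<close> is
  the trace.  Since \<open>2 \<le> \<bar>t\<bar>\<close>, the absolute values of the \<open>u\<^sub>k\<close> increase strictly, so that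
  \<open>u\<^sub>k \<noteq> 0\<close> for \<open>k > 0\<close>.
\<close>

lemma not_scalar_power:
  fixes P :: "int^2^2"
  assumes ns: "\<not> scalar P" and det: "P$1$1 * P$2$2 - P$1$2 * P$2$1 = 1"
    and tr: "2 \<le> \<bar>P$1$1 + P$2$2\<bar>"
    and Q0: "Q 0 = mat 1" and QSuc: "\<And>k. Q (Suc k) = P ** Q k"
  shows "\<not> scalar (Q (Suc k))"
proof -
  let ?t = "P$1$1 + P$2$2"
  have "\<exists>u u'. \<bar>u'\<bar> < \<bar>u\<bar> \<and> Q (Suc k) $1$2 = u * P$1$2 \<and> Q (Suc k) $2$1 = u * P$2$1 \<and>
               Q (Suc k) $1$1 = u * P$1$1 - u' \<and> Q (Suc k) $2$2 = u * P$2$2 - u'"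
  proof (induction k)
    case 0
    show ?case
      by (rule exI[of _ 1], rule exI[of _ 0]) (simp add: QSuc Q0)
  next
    case (Suc k)
    then obtain u u' where less: "\<bar>u'\<bar> < \<bar>u\<bar>"
      and Qk: "Q (Suc k) $1$2 = u * P$1$2" "Q (Suc k) $2$1 = u * P$2$1"
        "Q (Suc k) $1$1 = u * P$1$1 - u'" "Q (Suc k) $2$2 = u * P$2$2 - u'" by blast
    have "2 * \<bar>u\<bar> \<le> \<bar>?t\<bar> * \<bar>u\<bar>" using tr by (simp add: mult_right_mono)
    then have "\<bar>u\<bar> < \<bar>?t * u - u'\<bar>" using less by (simp add: abs_mult[symmetric])
    moreover have "Q (Suc (Suc k)) $1$2 = (?t * u - u') * P$1$2"
      "Q (Suc (Suc k)) $2$1 = (?t * u - u') * P$2$1"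
      "Q (Suc (Suc k)) $1$1 = (?t * u - u') * P$1$1 - u"
      "Q (Suc (Suc k)) $2$2 = (?t * u - u') * P$2$2 - u"
      unfolding QSuc[of "Suc k"] using arg_cong[OF det, of "\<lambda>n. u * n"]
      by (simp_all add: matrix_matrix_mult_def sum_2 Qk algebra_simps)
    ultimately show ?case by blast
  qed
  then obtain u u' where "\<bar>u'\<bar> < \<bar>u\<bar>" "Q (Suc k) $1$2 = u * P$1$2" "Q (Suc k) $2$1 = u * P$2$1"
    "Q (Suc k) $1$1 = u * P$1$1 - u'" "Q (Suc k) $2$2 = u * P$2$2 - u'" by blast
  with ns show ?thesis by (auto simp: scalar_def)
qed

text \<open>
  Two matrices commute if and only if their traceless parts are parallel: the three equations say that
  the cross product of the vectors \<open>(P\<^sub>1\<^sub>1 - P\<^sub>2\<^sub>2, P\<^sub>1\<^sub>2, P\<^sub>2\<^sub>1)\<close> and \<open>(Q\<^sub>1\<^sub>1 - Q\<^sub>2\<^sub>2, Q\<^sub>1\<^sub>2, Q\<^sub>2\<^sub>1)\<close> vanishes.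
\<close>

lemma commute_2x2_iff:
  fixes P Q :: "int^2^2"
  shows "P ** Q = Q ** P \<longleftrightarrow>
    P$1$2 * Q$2$1 = P$2$1 * Q$1$2 \<and>
    (P$1$1 - P$2$2) * Q$1$2 = P$1$2 * (Q$1$1 - Q$2$2) \<and>
    (P$1$1 - P$2$2) * Q$2$1 = P$2$1 * (Q$1$1 - Q$2$2)"
  by (auto simp: matrix_2_simps algebra_simps)

text \<open>
  If \<open>P\<close> is not scalar and commutes with \<open>Q\<close> and with two conjugates of \<open>Q\<close>, then the traceless parts of
  these three matrices lie on one line.  That line, if it were spanned by the traceless part of \<open>Q\<close>,
  would be invariant under conjugation by an upper and by a lower unipotent matrix, but these have
  no common invariant line.
\<close>

lemma scalar_if_commuting_conjugates:
  assumes P: "\<not> scalar P" and m: "m \<noteq> 0"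
    and c0: "P ** Q = Q ** P"
    and c1: "\<And>c. P ** (unipotent c m ** Q ** unipotent c (-m)) =
      (unipotent c m ** Q ** unipotent c (-m)) ** P"
  shows "scalar Q"
proof -
  define pd py pz where p: "pd = P$1$1 - P$2$2" "py = P$1$2" "pz = P$2$1"
  define d y z where q: "d = Q$1$1 - Q$2$2" "y = Q$1$2" "z = Q$2$1"
  have par: "py * z = pz * y" "pd * y = py * d" "pd * z = pz * d"
    using c0 by (auto simp: commute_2x2_iff p q)
  have par_up: "py * z = pz * (y - m * (d + m * z))" "pd * (y - m * (d + m * z)) = py * (d + 2 * m * z)"
    "pd * z = pz * (d + 2 * m * z)"
    using c1[of True] unfolding commute_2x2_iff p q
    by (simp_all add: unipotent_def matrix_2_simps algebra_simps)
  have par_lo: "py * (z + m * (d - m * y)) = pz * y" "pd * y = py * (d - 2 * m * y)"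
    using c1[of False] unfolding commute_2x2_iff p q
    by (simp_all add: unipotent_def matrix_2_simps algebra_simps)
  have "d = 0 \<and> y = 0 \<and> z = 0"
  proof -
    consider "pz \<noteq> 0" | "py \<noteq> 0" | "py = 0" "pz = 0" "pd \<noteq> 0"
      using P by (auto simp: scalar_def p)
    then show ?thesis
    proof cases
      case 1
      have "pz * (2 * m * z) = 0" "pz * (m * (d + m * z)) = 0"
        using par par_up by (simp_all add: algebra_simps)
      then have "z = 0" "d = 0" using 1 m by auto
      then show ?thesis using par 1 by simp
    next
      case 2
      have "py * (2 * m * y) = 0" "py * (m * (d - m * y)) = 0"
        using par par_lo by (simp_all add: algebra_simps)
      then have "y = 0" "d = 0" using 2 m by auto
      then show ?thesis using par 2 by simp
    next
      case 3
      then have "y = 0" "z = 0" using par by auto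
      then show ?thesis using 3 m par_up by simp
    qed
  qed
  then show ?thesis by (simp add: scalar_def q)
qed

section \<open>Free groups of rank at least two\<close>

definition letter :: "('g, 'm) monoid_scheme \<Rightarrow> 'g \<times> bool \<Rightarrow> 'g" where
  "letter G s = (if snd s then fst s else inv\<^bsub>G\<^esub> fst s)"

lemma word_value_Nil [simp]: "word_value G [] = \<one>\<^bsub>G\<^esub>"
  by (simp add: word_value_def)

lemma word_value_Cons [simp]: "word_value G (s # w) = letter G s \<otimes>\<^bsub>G\<^esub> word_value G w"
  by (cases s) (simp add: word_value_def letter_def)

context group
begin

lemma letter_closed: "fst s \<in> carrier G \<Longrightarrow> letter G s \<in> carrier G"
  by (simp add: letter_def)

lemma word_value_closed: "fst ` set w \<subseteq> carrier G \<Longrightarrow> word_value G w \<in> carrier G"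
  by (induction w) (auto intro: letter_closed)

lemma word_value_append:
  "fst ` set u \<subseteq> carrier G \<Longrightarrow> fst ` set v \<subseteq> carrier G \<Longrightarrow>
    word_value G (u @ v) = word_value G u \<otimes> word_value G v"
  by (induction u) (auto simp: m_assoc word_value_closed letter_closed)

lemma letter_cancel:
  "c \<in> carrier G \<Longrightarrow> x \<in> carrier G \<Longrightarrow> letter G (c, e) \<otimes> (letter G (c, \<not> e) \<otimes> x) = x"
  by (cases e) (simp_all add: letter_def m_assoc[symmetric])

text \<open>
  The effect of cancellation on a word is analysed here; statements about arbitrary words then follow
  by induction on the word.
\<close>

lemma reduced_word_Cons_cases:
  assumes C: "C \<subseteq> carrier G" and w: "w \<in> reduced_words C" and s: "fst s \<in> C"
  obtains "s # w \<in> reduced_words C"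
  | w' where "w = (fst s, \<not> snd s) # w'" "w' \<in> reduced_words C"
      "word_value G (s # w) = word_value G w'"
proof (cases "s # w \<in> reduced_words C")
  case False
  then obtain w' where w': "w = (fst s, \<not> snd s) # w'"
    using w s by (cases w) (auto simp: reduced_words_def successively_Cons prod_eq_iff)
  then have red: "w' \<in> reduced_words C"
    using w by (auto simp: reduced_words_def successively_Cons)
  have "letter G (fst s, snd s) \<otimes> (letter G (fst s, \<not> snd s) \<otimes> word_value G w') = word_value G w'"
    using red C s by (intro letter_cancel word_value_closed) (auto simp: reduced_words_def)
  then show thesis using that(2)[OF w' red] w' by simp
qed (use that in blast)

lemma reduced_word_exists:
  assumes C: "C \<subseteq> carrier G" and w: "fst ` set w \<subseteq> C"
  shows "\<exists>w'\<in>reduced_words C. word_value G w' = word_value G w"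
  using w
proof (induction w)
  case Nil
  then show ?case by (intro bexI[of _ "[]"]) (simp_all add: reduced_words_def)
next
  case (Cons s w)
  then obtain w' where w': "w' \<in> reduced_words C" "word_value G w' = word_value G w" by auto
  have "fst s \<in> C" using Cons.prems by simp
  from C w'(1) this show ?case
  proof (cases rule: reduced_word_Cons_cases)
    case 1
    then show ?thesis using w'(2) by (intro bexI[of _ "s # w'"]) simp_all
  next
    case (2 w'')
    then show ?thesis using w'(2) by (intro bexI[of _ w'']) simp_all
  qed
qed

lemma generate_imp_word_value:
  assumes C: "C \<subseteq> carrier G" and g: "g \<in> generate G C"
  shows "\<exists>w. fst ` set w \<subseteq> C \<and> g = word_value G w"
  using g
proof induction
  case one
  show ?case by (rule exI[of _ "[]"]) simp
next
  case (incl h)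
  then show ?case using C by (intro exI[of _ "[(h, True)]"]) (auto simp: letter_def)
next
  case (inv h)
  then show ?case using C by (intro exI[of _ "[(h, False)]"]) (auto simp: letter_def)
next
  case (eng h1 h2)
  then obtain u v where "fst ` set u \<subseteq> C" "h1 = word_value G u" "fst ` set v \<subseteq> C" "h2 = word_value G v"
    by blast
  then show ?case using C by (intro exI[of _ "u @ v"]) (auto simp: image_Un intro!: word_value_append[symmetric])
qed

text \<open>
  If there is at most one free generator, then all letters commute with each other, hence all words do.
\<close>

lemma nonabelian_free_group_two_generators:
  assumes free: "free_group_on G B" and nonab: "\<not> comm_group G"
  obtains a b where "a \<in> B" "b \<in> B" "a \<noteq> b"
proof -
  have "\<exists>a\<in>B. \<exists>b\<in>B. a \<noteq> b"
  proof (rule ccontr)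
    assume neg: "\<not> (\<exists>a\<in>B. \<exists>b\<in>B. a \<noteq> b)"
    have B: "B \<subseteq> carrier G" using free by (simp add: free_group_on_def)
    have one: "s = t" if "s \<in> B" "t \<in> B" for s t using neg that by auto
    have letters: "letter G s \<otimes> letter G t = letter G t \<otimes> letter G s" if "fst s \<in> B" "fst t \<in> B" for s t
      using one[OF that] that B by (auto simp: letter_def)
    have 1: "letter G s \<otimes> word_value G w = word_value G w \<otimes> letter G s"
      if "fst s \<in> B" "fst ` set w \<subseteq> B" for s w
      using that(2)
    proof (induction w)
      case (Cons t w)
      have cl: "letter G s \<in> carrier G" "letter G t \<in> carrier G" "word_value G w \<in> carrier G"
        using that Cons.prems B by (auto intro!: letter_closed word_value_closed)
      then show ?case
        using Cons letters[of s t] that by (simp add: m_assoc[symmetric]) (simp add: m_assoc)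
    qed (use that B in \<open>auto simp: letter_closed\<close>)
    have 2: "word_value G v \<otimes> word_value G w = word_value G w \<otimes> word_value G v"
      if "fst ` set v \<subseteq> B" "fst ` set w \<subseteq> B" for v w
      using that(1)
    proof (induction v)
      case (Cons t v)
      have cl: "word_value G v \<in> carrier G" "letter G t \<in> carrier G" "word_value G w \<in> carrier G"
        using that Cons.prems B by (auto intro!: letter_closed word_value_closed)
      then show ?case
        using Cons 1[of t w] that by (simp add: m_assoc) (simp add: m_assoc[symmetric])
    qed (use that B in \<open>auto simp: word_value_closed\<close>)
    have "carrier G = word_value G ` reduced_words B"
      using free by (simp add: free_group_on_def bij_betw_def)
    then have "x \<otimes> y = y \<otimes> x" if "x \<in> carrier G" "y \<in> carrier G" for x y
      using that 2 by (auto simp: reduced_words_def)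
    then have "comm_group G" by (rule group_comm_groupI)
    then show False using nonab by simp
  qed
  then show thesis using that by blast
qed

text \<open>
  The universal property of a free group, for the map that sends \<open>a\<close> to the upper and every other
  free generator to the lower Sanov matrix.  Injectivity is only claimed, in the strong form that
  nontrivial elements have non-scalar images, on the subgroup generated by \<open>a\<close> and \<open>b\<close>: its
  elements are the values of the reduced words in \<open>a\<close> and \<open>b\<close>.
\<close>

lemma sanov_representation:
  assumes free: "free_group_on G B" and ab: "a \<in> B" "b \<in> B" "a \<noteq> b"
  shows "\<exists>\<phi>. \<phi> \<one> = mat 1 \<and>
    (\<forall>g\<in>carrier G. \<forall>h\<in>carrier G. \<phi> (g \<otimes> h) = \<phi> g ** \<phi> h) \<and>
    \<phi> a = unipotent True 2 \<and> \<phi> b = unipotent False 2 \<and>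
    (\<forall>g\<in>generate G {a, b}. \<exists>w. \<phi> g = sanov_word w) \<and>
    (\<forall>g\<in>generate G {a, b}. g \<noteq> \<one> \<longrightarrow> \<not> scalar (\<phi> g))"
proof -
  have B: "B \<subseteq> carrier G" and bij: "bij_betw (word_value G) (reduced_words B) (carrier G)"
    using free by (simp_all add: free_group_on_def)
  define f where "f = (\<lambda>s::'a \<times> bool. (fst s = a, snd s))"
  define M where "M w = sanov_word (map f w)" for w
  \<comment> \<open>The value on a group element is read off its unique reduced word.\<close>
  define \<phi> where "\<phi> g = M (inv_into (reduced_words B) (word_value G) g)" for g
  have \<phi>_reduced: "\<phi> (word_value G w) = M w" if "w \<in> reduced_words B" for w
    unfolding \<phi>_def using that bij by (simp add: bij_betw_def inv_into_f_f)
  have M_append: "M (u @ v) = M u ** M v" for u v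
    by (simp add: M_def sanov_word_append)
  have M_Cons: "M (s # w) = sanov (f s) ** M w" for s w
    by (simp add: M_def sanov_word_Cons)
  have \<phi>_word: "\<phi> (word_value G w) = M w" if "fst ` set w \<subseteq> B" for w
    using that
  proof (induction w)
    case Nil
    show ?case using \<phi>_reduced[of "[]"] by (simp add: reduced_words_def)
  next
    case (Cons s w)
    then obtain w' where w': "w' \<in> reduced_words B" "word_value G w' = word_value G w"
      using reduced_word_exists[OF B, of w] by auto
    then have M': "M w' = M w" using \<phi>_reduced[of w'] Cons by auto
    have "fst s \<in> B" using Cons.prems by simp
    from B w'(1) this show ?case
    proof (cases rule: reduced_word_Cons_cases)
      case 1
      then show ?thesis using \<phi>_reduced[of "s # w'"] w' M' by (simp add: M_Cons)
    next
      case (2 w'')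
      have "M (s # w) = M w''"
        by (simp add: M_Cons M'[symmetric] 2(1) f_def matrix_mul_assoc sanov_cancel)
      then show ?thesis using \<phi>_reduced[OF 2(2)] 2(3) w'(2) by simp
    qed
  qed
  have word: "\<exists>w. fst ` set w \<subseteq> B \<and> g = word_value G w" if "g \<in> carrier G" for g
    using that bij by (force simp: bij_betw_def reduced_words_def)
  show ?thesis
  proof (intro exI[of _ \<phi>] conjI ballI impI)
    show "\<phi> \<one> = mat 1" using \<phi>_word[of "[]"] by (simp add: M_def sanov_word_def)
    show "\<phi> (g \<otimes> h) = \<phi> g ** \<phi> h" if gh: "g \<in> carrier G" "h \<in> carrier G" for g h
    proof -
      obtain u v where uv: "fst ` set u \<subseteq> B" "g = word_value G u" "fst ` set v \<subseteq> B" "h = word_value G v"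
        using word gh by metis
      then have "g \<otimes> h = word_value G (u @ v)" using B word_value_append[of u v] by auto
      then show ?thesis using \<phi>_word[of "u @ v"] \<phi>_word[of u] \<phi>_word[of v] uv
        by (simp add: image_Un M_append)
    qed
    have gen: "\<phi> c = sanov (f (c, True))" if "c \<in> B" for c
    proof -
      have "\<phi> c = M [(c, True)]" using \<phi>_word[of "[(c, True)]"] that B by (auto simp: letter_def)
      then show ?thesis by (simp add: M_def sanov_word_def)
    qed
    show "\<phi> a = unipotent True 2" "\<phi> b = unipotent False 2"
      using gen ab by (auto simp: sanov_def f_def)
    have red: "\<exists>w\<in>reduced_words {a, b}. g = word_value G w" if "g \<in> generate G {a, b}" for g
    proof -
      have ab': "{a, b} \<subseteq> carrier G" using ab B by blast
      show ?thesis
        using generate_imp_word_value[OF ab' that] reduced_word_exists[OF ab'] by metis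
    qed
    show "\<exists>w. \<phi> g = sanov_word w" if "g \<in> generate G {a, b}" for g
    proof -
      obtain w where "w \<in> reduced_words {a, b}" "g = word_value G w" using red[OF \<open>g \<in> _\<close>] by blast
      moreover have "fst ` set w \<subseteq> B" using calculation ab by (auto simp: reduced_words_def)
      ultimately show ?thesis using \<phi>_word by (auto simp: M_def)
    qed
    show "\<not> scalar (\<phi> g)" if g: "g \<in> generate G {a, b}" "g \<noteq> \<one>" for g
    proof -
      obtain w where w: "w \<in> reduced_words {a, b}" "g = word_value G w" using red[OF g(1)] by blast
      have fst_w: "fst ` set w \<subseteq> {a, b}" and red: "successively no_cancel w"
        using w by (auto simp: reduced_words_def)
      have "successively no_cancel (map f w)"
        using red fst_w ab(3) unfolding successively_map
        by (elim successively_mono) (auto simp: f_def)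
      moreover have "map f w \<noteq> []" using g w by auto
      moreover have "\<phi> g = M w" using w(2) \<phi>_word[of w] fst_w ab by auto
      ultimately show ?thesis using sanov_word_not_scalar by (auto simp: M_def)
    qed
  qed
qed

end

lemma (in group) free_group_torsion_free:
  assumes free: "free_group_on G B" and ab: "a \<in> B" "b \<in> B" "a \<noteq> b"
    and g: "g \<in> generate G {a, b}" "g \<noteq> \<one>" and k: "0 < k"
  shows "g [^] (k::nat) \<noteq> \<one>"
proof -
  obtain \<phi> where \<phi>: "\<phi> \<one> = mat 1"
    "\<forall>g\<in>carrier G. \<forall>h\<in>carrier G. \<phi> (g \<otimes> h) = \<phi> g ** \<phi> h"
    "\<phi> a = unipotent True 2" "\<phi> b = unipotent False 2"
    "\<forall>g\<in>generate G {a, b}. \<exists>w. \<phi> g = sanov_word w"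
    "\<forall>g\<in>generate G {a, b}. g \<noteq> \<one> \<longrightarrow> \<not> scalar (\<phi> g)"
    using sanov_representation[OF free ab] by blast
  have "{a, b} \<subseteq> carrier G" using free ab by (auto simp: free_group_on_def)
  then have gG: "g \<in> carrier G" using g(1) by (rule generate_in_carrier)
  obtain w where w: "\<phi> g = sanov_word w" using \<phi>(5) g(1) by blast
  obtain j where j: "k = Suc j" using k by (cases k) auto
  have "\<not> scalar (\<phi> (g [^] k))"
    unfolding j
  proof (rule not_scalar_power[of "\<phi> g" "\<lambda>k. \<phi> (g [^] k)"])
    show "\<phi> (g [^] Suc k) = \<phi> g ** \<phi> (g [^] k)" for k :: nat
      unfolding nat_pow_Suc2[OF gG] using gG by (intro \<phi>(2)[rule_format]) simp_all
    show "\<not> scalar (\<phi> g)" using \<phi>(6) g by blast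
    show "\<phi> (g [^] (0::nat)) = mat 1" using \<phi>(1) by simp
  qed (use w sanov_word_det sanov_word_trace in simp_all)
  then show ?thesis using \<phi>(1) by (auto simp: scalar_def mat_def)
qed

text \<open>
  Commuting is a transitive relation on the nontrivial elements of a free group.  So otherwise \<open>h\<close>
  would commute with its conjugates by \<open>a\<^sup>k\<close> and \<open>b\<^sup>k\<close>, hence with these powers themselves, which do
  not commute with each other.  The proof happens in \<open>SL(2, \<int>)\<close>, where the powers become unipotent
  matrices.  The exponent \<open>k\<close> matters because later only elements that preserve certain open sets may be
  used for conjugation, and powers are such elements.
\<close>

lemma (in group) free_group_noncommuting_conjugate:
  assumes free: "free_group_on G B" and ab: "a \<in> B" "b \<in> B" "a \<noteq> b"
    and g: "g \<in> generate G {a, b}" "g \<noteq> \<one>" and h: "h \<in> generate G {a, b}" "h \<noteq> \<one>"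
    and k: "0 < k"
  shows "\<exists>c\<in>{\<one>, a, b}. g \<otimes> (c [^] (k::nat) \<otimes> h \<otimes> inv (c [^] k)) \<noteq> (c [^] k \<otimes> h \<otimes> inv (c [^] k)) \<otimes> g"
proof (rule ccontr)
  assume "\<not> ?thesis"
  then have comm: "g \<otimes> (c [^] k \<otimes> h \<otimes> inv (c [^] k)) = (c [^] k \<otimes> h \<otimes> inv (c [^] k)) \<otimes> g"
    if "c \<in> {\<one>, a, b}" for c using that by blast
  obtain \<phi> where \<phi>: "\<phi> \<one> = mat 1"
    "\<forall>g\<in>carrier G. \<forall>h\<in>carrier G. \<phi> (g \<otimes> h) = \<phi> g ** \<phi> h"
    "\<phi> a = unipotent True 2" "\<phi> b = unipotent False 2"
    "\<forall>g\<in>generate G {a, b}. \<exists>w. \<phi> g = sanov_word w"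
    "\<forall>g\<in>generate G {a, b}. g \<noteq> \<one> \<longrightarrow> \<not> scalar (\<phi> g)"
    using sanov_representation[OF free ab] by blast
  have abG: "a \<in> carrier G" "b \<in> carrier G" using free ab by (auto simp: free_group_on_def)
  then have "{a, b} \<subseteq> carrier G" by simp
  then have gh: "g \<in> carrier G" "h \<in> carrier G" using g(1) h(1) generate_in_carrier by blast+
  have pow: "\<phi> (c [^] n) = unipotent e (2 * int n)"
    if "c \<in> carrier G" "\<phi> c = unipotent e 2" for c e and n :: nat
    using that \<phi>(1) by (induction n) (simp_all add: \<phi>(2) unipotent_0 unipotent_add add.commute)
  have inv: "\<phi> (inv x) = unipotent e (-m)" if "x \<in> carrier G" "\<phi> x = unipotent e m" for x e m
  proof -
    have "\<phi> (inv x) ** unipotent e m = mat 1"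
      using \<phi>(2)[rule_format, of "inv x" x] that \<phi>(1) by simp
    then have "(\<phi> (inv x) ** unipotent e m) ** unipotent e (-m) = unipotent e (-m)"
      by simp
    then show ?thesis by (simp add: matrix_mul_assoc[symmetric] unipotent_add unipotent_0)
  qed
  have conj: "\<phi> g ** (unipotent e m ** \<phi> h ** unipotent e (-m)) =
      (unipotent e m ** \<phi> h ** unipotent e (-m)) ** \<phi> g" (is "?eq")
    if c: "c \<in> {a, b}" "\<phi> c = unipotent e 2" and m: "m = 2 * int k" for c e m
  proof -
    have cG: "c \<in> carrier G" using c abG by auto
    then have "\<phi> (c [^] k) = unipotent e m" using pow c m by simp
    then show ?thesis
      using arg_cong[OF comm[of c], of \<phi>] inv[of "c [^] k" e m] cG gh c by (auto simp: \<phi>(2))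
  qed
  have "scalar (\<phi> h)"
  proof (rule scalar_if_commuting_conjugates[of "\<phi> g" "2 * int k"])
    show "\<not> scalar (\<phi> g)" using \<phi>(6) g by blast
    show "\<phi> g ** \<phi> h = \<phi> h ** \<phi> g"
      using arg_cong[OF comm[of \<one>], of \<phi>] gh by (simp add: \<phi>(2))
    show "\<phi> g ** (unipotent e (2 * int k) ** \<phi> h ** unipotent e (- (2 * int k))) =
      unipotent e (2 * int k) ** \<phi> h ** unipotent e (- (2 * int k)) ** \<phi> g" for e
      using conj[of a True] conj[of b False] \<phi>(3,4) by (cases e) auto
  qed (use k in simp)
  then show False using \<phi>(6) h by blast
qed

section \<open>Actions on compact spaces and points with free germs\<close>

locale topological_action = group G
  for G :: "('g, 'm) monoid_scheme" (structure) +
  fixes M :: "'x topology" and act :: "'g \<Rightarrow> 'x \<Rightarrow> 'x"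
  assumes act_continuous: "g \<in> carrier G \<Longrightarrow> continuous_map M M (act g)"
    and act_one: "x \<in> topspace M \<Longrightarrow> act \<one> x = x"
    and act_mult: "g \<in> carrier G \<Longrightarrow> h \<in> carrier G \<Longrightarrow> x \<in> topspace M \<Longrightarrow>
      act (g \<otimes> h) x = act g (act h x)"
begin

text \<open>
  Equality of germs, expressed by the maps alone: it can be transferred between a group and its
  subgroups, whereas a germ is an equivalence class of elements of a particular group.
\<close>

definition agree_near :: "'g \<Rightarrow> 'g \<Rightarrow> 'x \<Rightarrow> bool" where
  "agree_near g h x \<longleftrightarrow> (\<exists>U. openin M U \<and> x \<in> U \<and> (\<forall>y\<in>U. act g y = act h y))"

lemma act_in: "g \<in> carrier G \<Longrightarrow> x \<in> topspace M \<Longrightarrow> act g x \<in> topspace M"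
  using act_continuous by (fastforce simp: continuous_map_def)

lemma act_inv: "g \<in> carrier G \<Longrightarrow> x \<in> topspace M \<Longrightarrow> act (inv g) (act g x) = x"
  using act_mult[of "inv g" g x] act_one by simp

lemma act_inv': "g \<in> carrier G \<Longrightarrow> x \<in> topspace M \<Longrightarrow> act g (act (inv g) x) = x"
  using act_inv[of "inv g" x] by simp

lemma inv_mult_one_imp_eq:
  "g \<in> carrier G \<Longrightarrow> h \<in> carrier G \<Longrightarrow> inv h \<otimes> g = \<one> \<Longrightarrow> g = h"
  using inv_solve_left[of \<one> h g] by simp

lemma agree_near_refl: "x \<in> topspace M \<Longrightarrow> agree_near g g x"
  unfolding agree_near_def by (rule exI[of _ "topspace M"]) simp

lemma agree_near_sym: "agree_near g h x \<Longrightarrow> agree_near h g x"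
  unfolding agree_near_def by metis

lemma agree_near_trans:
  assumes "agree_near g h x" "agree_near h k x"
  shows "agree_near g k x"
proof -
  obtain U W where "openin M U" "x \<in> U" "\<forall>y\<in>U. act g y = act h y"
    "openin M W" "x \<in> W" "\<forall>y\<in>W. act h y = act k y"
    using assms unfolding agree_near_def by blast
  then show ?thesis unfolding agree_near_def by (intro exI[of _ "U \<inter> W"]) auto
qed

lemma agree_near_mult:
  assumes "g \<in> carrier G" "g' \<in> carrier G" "h \<in> carrier G" "h' \<in> carrier G" "x \<in> topspace M"
    and "agree_near g g' (act h x)" "agree_near h h' x"
  shows "agree_near (g \<otimes> h) (g' \<otimes> h') x"
proof -
  obtain U W where U: "openin M U" "act h x \<in> U" "\<forall>y\<in>U. act g y = act g' y"
    and W: "openin M W" "x \<in> W" "\<forall>y\<in>W. act h y = act h' y"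
    using assms(6,7) unfolding agree_near_def by blast
  let ?Z = "{y \<in> topspace M. act h y \<in> U} \<inter> W"
  have "openin M ?Z"
    using openin_continuous_map_preimage[OF act_continuous[OF assms(3)] U(1)] W(1) by blast
  moreover have "act (g \<otimes> h) y = act (g' \<otimes> h') y" if "y \<in> ?Z" for y
    using that U(3) W(3) assms act_mult[of g h y] act_mult[of g' h' y] by auto
  ultimately show ?thesis
    unfolding agree_near_def using assms(5) U(2) W(2) by (intro exI[of _ ?Z]) auto
qed

lemma agree_near_inv:
  assumes "g \<in> carrier G" "h \<in> carrier G" "x \<in> topspace M" "agree_near g h x"
  shows "agree_near (inv g) (inv h) (act g x)"
proof -
  obtain U where U: "openin M U" "x \<in> U" "\<forall>y\<in>U. act g y = act h y"
    using assms(4) unfolding agree_near_def by blast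
  let ?Z = "{y \<in> topspace M. act (inv g) y \<in> U}"
  have "openin M ?Z"
    using openin_continuous_map_preimage[OF act_continuous[OF inv_closed[OF assms(1)]] U(1)] .
  moreover have "act g x \<in> ?Z" using assms U(2) act_in act_inv by simp
  moreover have "act (inv g) y = act (inv h) y" if "y \<in> ?Z" for y
    using that U(3) assms act_in[of "inv g" y] act_inv'[of g y] act_inv[of h "act (inv g) y"] by auto
  ultimately show ?thesis unfolding agree_near_def by blast
qed

lemma agree_near_imp_fixes:
  assumes "g \<in> carrier G" "h \<in> carrier G" "x \<in> topspace M" "agree_near g h x"
  shows "agree_near (inv h \<otimes> g) \<one> x"
proof -
  have "agree_near (inv h \<otimes> g) (inv h \<otimes> h) x"
    using assms by (intro agree_near_mult agree_near_refl act_in) auto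
  then show ?thesis using assms by simp
qed

text \<open>
  For \<open>y \<in> U\<close> also \<open>h y \<in> U\<close>, so both \<open>g h y\<close> and \<open>h g y\<close> are \<open>h y\<close>; for \<open>y \<in> W\<close> the roles are exchanged.
  So the commutator combines two regions of triviality into one.
\<close>

lemma commutator_fixes_union:
  assumes gh: "g \<in> carrier G" "h \<in> carrier G" and sub: "U \<subseteq> topspace M" "W \<subseteq> topspace M"
    and g: "\<And>y. y \<in> U \<Longrightarrow> act g y = y" "act g ` W \<subseteq> W"
    and h: "\<And>y. y \<in> W \<Longrightarrow> act h y = y" "act h ` U \<subseteq> U"
    and y: "y \<in> U \<union> W"
  shows "act (inv (h \<otimes> g) \<otimes> (g \<otimes> h)) y = y"
proof -
  have yM: "y \<in> topspace M" using y sub by blast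
  have "act g (act h y) = act h (act g y)"
    using y g h by (auto simp: image_subset_iff)
  then have "act (g \<otimes> h) y = act (h \<otimes> g) y" using gh yM by (simp add: act_mult)
  then show ?thesis
    using gh yM act_inv[of "h \<otimes> g" y] by (simp add: act_mult)
qed

text \<open>
  Suppose that near every point some nontrivial element of \<open>L\<close> is trivial.  By compactness, finitely
  many open sets \<open>W\<^sub>i\<close> cover the space such that on each of them a nontrivial \<open>g\<^sub>i \<in> L\<close> is trivial, and
  all \<open>n\<close>-th powers of group elements preserve all the \<open>W\<^sub>i\<close>, for a suitable \<open>n\<close>.  As \<open>L\<close> is torsion
  free, \<open>g\<^sub>i\<close> can be replaced by \<open>g\<^sub>i\<^sup>n\<close>.  Iterated commutators of conjugates of these powers are
  trivial on larger and larger unions of the \<open>W\<^sub>i\<close>, and they can be chosen to be nontrivial elements,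
  because \<open>L\<close> contains elements whose \<open>n\<close>-th powers conjugate one factor so that it does not commute
  with the other one.  The last commutator acts trivially everywhere, which contradicts faithfulness.
\<close>

proposition exists_point_with_free_germs:
  assumes compact: "compact_space M"
    and faithful: "\<And>g. g \<in> carrier G \<Longrightarrow> (\<And>x. x \<in> topspace M \<Longrightarrow> act g x = x) \<Longrightarrow> g = \<one>"
    and stable: "\<And>x U. openin M U \<Longrightarrow> x \<in> U \<Longrightarrow> \<exists>W k. openin M W \<and> x \<in> W \<and> W \<subseteq> U \<and>
      0 < (k::nat) \<and> (\<forall>g\<in>carrier G. act (g [^] k) ` W \<subseteq> W)"
    and L: "subgroup L G" and nontrivial: "L \<noteq> {\<one>}"
    and torsion_free: "\<And>g k. g \<in> L \<Longrightarrow> g \<noteq> \<one> \<Longrightarrow> 0 < (k::nat) \<Longrightarrow> g [^] k \<noteq> \<one>"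
    and noncommuting: "\<And>g h k. g \<in> L \<Longrightarrow> g \<noteq> \<one> \<Longrightarrow> h \<in> L \<Longrightarrow> h \<noteq> \<one> \<Longrightarrow> 0 < (k::nat) \<Longrightarrow>
      \<exists>c\<in>L. g \<otimes> (c [^] k \<otimes> h \<otimes> inv (c [^] k)) \<noteq> (c [^] k \<otimes> h \<otimes> inv (c [^] k)) \<otimes> g"
  shows "\<exists>x\<in>topspace M. \<forall>g\<in>L. \<forall>h\<in>L. agree_near g h x \<longrightarrow> g = h"
proof (rule ccontr)
  assume neg: "\<not> ?thesis"
  interpret L: subgroup L G by (rule L)
  note LG = L.mem_carrier
  have "\<exists>W g k. openin M W \<and> x \<in> W \<and> 0 < (k::nat) \<and> (\<forall>h\<in>carrier G. act (h [^] k) ` W \<subseteq> W) \<and>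
      g \<in> L \<and> g \<noteq> \<one> \<and> (\<forall>y\<in>W. act g y = y)" if x: "x \<in> topspace M" for x
  proof -
    obtain g h where gh: "g \<in> L" "h \<in> L" "agree_near g h x" "g \<noteq> h" using neg x by blast
    then have "agree_near (inv h \<otimes> g) \<one> x" using agree_near_imp_fixes x LG by blast
    then obtain U where U: "openin M U" "x \<in> U" "\<forall>y\<in>U. act (inv h \<otimes> g) y = act \<one> y"
      unfolding agree_near_def by blast
    obtain W k where W: "openin M W" "x \<in> W" "W \<subseteq> U" "0 < (k::nat)"
      "\<forall>g\<in>carrier G. act (g [^] k) ` W \<subseteq> W"
      using stable[OF U(1,2)] by blast
    have "inv h \<otimes> g \<in> L" using gh by blast
    moreover have "inv h \<otimes> g \<noteq> \<one>"
    proof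
      assume "inv h \<otimes> g = \<one>"
      then have "g = h" by (rule inv_mult_one_imp_eq[OF LG[OF gh(1)] LG[OF gh(2)]])
      then show False using gh by simp
    qed
    moreover have "\<forall>y\<in>W. act (inv h \<otimes> g) y = y"
    proof
      fix y assume "y \<in> W"
      then have "y \<in> U" "y \<in> topspace M" using W(3) openin_subset[OF U(1)] by auto
      then show "act (inv h \<otimes> g) y = y" using U(3) act_one by simp
    qed
    ultimately show ?thesis using W by blast
  qed
  then obtain W g k where Wgk: "\<And>x. x \<in> topspace M \<Longrightarrow> openin M (W x) \<and> x \<in> W x \<and> 0 < (k x::nat) \<and>
      (\<forall>h\<in>carrier G. act (h [^] k x) ` W x \<subseteq> W x) \<and>
      g x \<in> L \<and> g x \<noteq> \<one> \<and> (\<forall>y\<in>W x. act (g x) y = y)"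
    by metis
  obtain I where I: "finite I" "I \<subseteq> topspace M" "topspace M \<subseteq> \<Union> (W ` I)"
  proof -
    have "\<And>X. X \<in> W ` topspace M \<Longrightarrow> openin M X" "topspace M \<subseteq> \<Union> (W ` topspace M)"
      using Wgk by auto
    then obtain \<F> where "finite \<F>" "\<F> \<subseteq> W ` topspace M" "topspace M \<subseteq> \<Union>\<F>"
      using compactinD[OF compact[unfolded compact_space_def]] by metis
    moreover from this obtain J where "J \<subseteq> topspace M" "finite J" "\<F> = W ` J"
      using finite_subset_image by meson
    ultimately show thesis using that by blast
  qed
  \<comment> \<open>The product serves as one exponent for all sets of the cover.\<close>
  define n where "n = (\<Prod>i\<in>I. k i)"
  have n: "0 < n" using I Wgk by (auto simp: n_def intro!: prod_pos)
  define K where "K = {h \<in> L. \<forall>i\<in>I. act h ` W i \<subseteq> W i \<and> act (inv h) ` W i \<subseteq> W i}"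
  have WM: "W i \<subseteq> topspace M" if "i \<in> I" for i
  proof -
    have "openin M (W i)" using that Wgk I(2) by blast
    then show ?thesis by (rule openin_subset)
  qed
  have power_W: "act (h [^] n) ` W i \<subseteq> W i" if h: "h \<in> carrier G" and i: "i \<in> I" for h i
  proof -
    have "k i dvd n" using i I by (simp add: n_def dvd_prodI)
    then obtain m where m: "n = m * k i" by (metis dvd_div_mult_self)
    have "(h [^] m) [^] k i = h [^] n" using h by (simp add: nat_pow_pow m)
    moreover have "act ((h [^] m) [^] k i) ` W i \<subseteq> W i"
      using Wgk[of i] i I h by blast
    ultimately show ?thesis by simp
  qed
  have power_K: "h [^] n \<in> K" if "h \<in> L" for h
  proof -
    have "h [^] m \<in> L" for m :: nat using that by (induction m) (simp_all add: L.m_closed)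
    moreover have "inv (h [^] n) = (inv h) [^] n" using LG that by (simp add: nat_pow_inv)
    ultimately show ?thesis using power_W LG that by (auto simp: K_def)
  qed
  have K_mult: "x \<otimes> y \<in> K" if "x \<in> K" "y \<in> K" for x y
  proof -
    have preserve: "act (x \<otimes> y) ` W i \<subseteq> W i"
      if "x \<in> carrier G" "y \<in> carrier G" "i \<in> I" "act x ` W i \<subseteq> W i" "act y ` W i \<subseteq> W i" for i x y
    proof
      fix z assume "z \<in> act (x \<otimes> y) ` W i"
      then obtain w where w: "w \<in> W i" "z = act (x \<otimes> y) w" by blast
      then have "z = act x (act y w)" using that WM act_mult by blast
      then show "z \<in> W i" using that(4,5) w(1) by blast
    qed
    have xy: "x \<in> L" "y \<in> L" using that by (simp_all add: K_def)
    then have G: "x \<in> carrier G" "y \<in> carrier G" using LG by auto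
    have "act (x \<otimes> y) ` W i \<subseteq> W i" if i: "i \<in> I" for i
      using preserve[OF G i] \<open>x \<in> K\<close> \<open>y \<in> K\<close> i unfolding K_def by blast
    moreover have "act (inv (x \<otimes> y)) ` W i \<subseteq> W i" if i: "i \<in> I" for i
      unfolding inv_mult_group[OF G]
      using preserve[OF inv_closed[OF G(2)] inv_closed[OF G(1)] i] \<open>x \<in> K\<close> \<open>y \<in> K\<close> i
      unfolding K_def by blast
    ultimately show ?thesis using xy L.m_closed unfolding K_def by blast
  qed
  have K_inv: "inv x \<in> K" if "x \<in> K" for x
    using that LG by (auto simp: K_def)
  have K_L: "x \<in> L" if "x \<in> K" for x using that by (simp add: K_def)
  \<comment> \<open>The induction adds the sets of the cover one by one; the elements stay in the
      group \<open>K\<close> of those elements of \<open>L\<close> that preserve all sets.\<close>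
  have "\<exists>h\<in>K. h \<noteq> \<one> \<and> (\<forall>y\<in>\<Union> (W ` J). act h y = y)" if "J \<subseteq> I" for J
    using finite_subset[OF that I(1)] that
  proof (induction J)
    case empty
    obtain h where "h \<in> L" "h \<noteq> \<one>" using nontrivial L.one_closed by blast
    then show ?case using power_K torsion_free n by (intro bexI[of _ "h [^] n"]) auto
  next
    case (insert i J)
    then obtain h where h: "h \<in> K" "h \<noteq> \<one>" "\<And>y. y \<in> \<Union> (W ` J) \<Longrightarrow> act h y = y" by auto
    have i: "i \<in> I" "i \<in> topspace M" using insert.prems I by auto
    have gi: "g i \<in> L" "g i \<noteq> \<one>" "\<And>y. y \<in> W i \<Longrightarrow> act (g i) y = y" using Wgk i by auto
    define f where "f = g i [^] n"
    have f: "f \<in> K" "f \<noteq> \<one>" using power_K torsion_free n gi by (auto simp: f_def)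
    have f_fix: "act f y = y" if "y \<in> W i" for y
    proof -
      have "y \<in> topspace M" using that WM i by blast
      then have "act (g i [^] m) y = y" for m :: nat
        using that gi LG by (induction m) (simp_all add: act_one act_mult)
      then show ?thesis by (simp add: f_def)
    qed
    obtain c where c: "c \<in> L"
      "h \<otimes> (c [^] n \<otimes> f \<otimes> inv (c [^] n)) \<noteq> (c [^] n \<otimes> f \<otimes> inv (c [^] n)) \<otimes> h"
      using noncommuting[OF K_L[OF h(1)] h(2) K_L[OF f(1)] f(2) n] by blast
    define f' where "f' = c [^] n \<otimes> f \<otimes> inv (c [^] n)"
    have cK: "c [^] n \<in> K" using power_K c by blast
    have f': "f' \<in> K" unfolding f'_def by (intro K_mult K_inv cK f(1))
    have f'_fix: "act f' y = y" if "y \<in> W i" for y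
    proof -
      have y: "y \<in> topspace M" using that WM i by blast
      have cG: "c [^] n \<in> carrier G" "f \<in> carrier G" using cK f K_L LG by auto
      have "act (inv (c [^] n)) y \<in> W i" using cK i that by (auto simp: K_def)
      then show ?thesis
        unfolding f'_def using y cG f_fix act_inv'[of "c [^] n" y]
        by (simp add: act_mult act_in)
    qed
    have carr: "h \<in> carrier G" "f' \<in> carrier G" using h f' K_L LG by auto
    let ?e = "inv (f' \<otimes> h) \<otimes> (h \<otimes> f')"
    have "?e \<in> K" by (intro K_mult K_inv h(1) f')
    moreover have "?e \<noteq> \<one>"
    proof
      assume "?e = \<one>"
      then have "h \<otimes> f' = f' \<otimes> h"
        by (rule inv_mult_one_imp_eq[OF m_closed[OF carr] m_closed[OF carr(2,1)]])
      then show False using c(2) unfolding f'_def by contradiction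
    qed
    moreover have "\<forall>y\<in>\<Union> (W ` insert i J). act ?e y = y"
    proof
      fix y assume y: "y \<in> \<Union> (W ` insert i J)"
      show "act ?e y = y"
      proof (rule commutator_fixes_union[OF carr, of "\<Union> (W ` J)" "W i"])
        show "\<Union> (W ` J) \<subseteq> topspace M" using WM insert.prems by blast
        show "W i \<subseteq> topspace M" using WM i by blast
        show "act h ` W i \<subseteq> W i" using h(1) i unfolding K_def by blast
        show "act f' ` \<Union> (W ` J) \<subseteq> \<Union> (W ` J)"
          using f' insert.prems unfolding K_def by blast
        show "y \<in> \<Union> (W ` J) \<union> W i" using y by auto
      qed (fact h(3), fact f'_fix)
    qed
    ultimately show ?case by (intro bexI[of _ ?e] conjI)
  qed
  then obtain h where h: "h \<in> K" "h \<noteq> \<one>" "\<forall>y\<in>\<Union> (W ` I). act h y = y" by blast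
  have "h = \<one>"
    using h(3) I(3) by (intro faithful LG K_L h(1)) blast
  then show False using h(2) by contradiction
qed

corollary free_group_exists_point_with_free_germs:
  assumes compact: "compact_space M"
    and faithful: "\<And>g. g \<in> carrier G \<Longrightarrow> (\<And>x. x \<in> topspace M \<Longrightarrow> act g x = x) \<Longrightarrow> g = \<one>"
    and stable: "\<And>x U. openin M U \<Longrightarrow> x \<in> U \<Longrightarrow> \<exists>W k. openin M W \<and> x \<in> W \<and> W \<subseteq> U \<and>
      0 < (k::nat) \<and> (\<forall>g\<in>carrier G. act (g [^] k) ` W \<subseteq> W)"
    and free: "free_group_on G B" and ab: "a \<in> B" "b \<in> B" "a \<noteq> b"
  shows "\<exists>x\<in>topspace M. \<forall>g\<in>generate G {a, b}. \<forall>h\<in>generate G {a, b}. agree_near g h x \<longrightarrow> g = h"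
proof (rule exists_point_with_free_germs[OF compact faithful stable])
  have abG: "{a, b} \<subseteq> carrier G" using free ab by (auto simp: free_group_on_def)
  show "subgroup (generate G {a, b}) G" using abG by (rule generate_is_subgroup)
  have "a \<in> generate G {a, b}" "b \<in> generate G {a, b}" by (auto intro: generate.incl)
  then show "generate G {a, b} \<noteq> {\<one>}" using ab by auto
  show "g [^] k \<noteq> \<one>" if "g \<in> generate G {a, b}" "g \<noteq> \<one>" "0 < k" for g and k :: nat
    using free_group_torsion_free[OF free ab that] .
  show "\<exists>c\<in>generate G {a, b}.
      g \<otimes> (c [^] k \<otimes> h \<otimes> inv (c [^] k)) \<noteq> (c [^] k \<otimes> h \<otimes> inv (c [^] k)) \<otimes> g"
    if "g \<in> generate G {a, b}" "g \<noteq> \<one>" "h \<in> generate G {a, b}" "h \<noteq> \<one>" "0 < k"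
    for g h and k :: nat
    using free_group_noncommuting_conjugate[OF free ab that] generate.one[of G "{a, b}"]
      \<open>a \<in> generate G {a, b}\<close> \<open>b \<in> generate G {a, b}\<close> by blast
qed

end

section \<open>The growth of the groupoid of germs\<close>

definition positive_word :: "'g \<Rightarrow> 'g \<Rightarrow> bool list \<Rightarrow> ('g \<times> bool) list" where
  "positive_word a b u = map (\<lambda>c. (if c then a else b, True)) u"

lemma word_value_positive_Cons:
  "word_value G (positive_word a b (c # u)) =
    (if c then a else b) \<otimes>\<^bsub>G\<^esub> word_value G (positive_word a b u)"
  by (simp add: positive_word_def letter_def)

context topological_action
begin

lemma germ_eq_iff:
  assumes "g \<in> carrier G" "h \<in> carrier G" "x \<in> topspace M"
  shows "germ G M act g x = germ G M act h y \<longleftrightarrow> x = y \<and> agree_near g h x"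
proof
  have "(g, x) \<in> germ G M act g x"
    unfolding germ_def germ_rel_def using assms agree_near_refl[of x g]
    by (auto simp: agree_near_def)
  moreover assume "germ G M act g x = germ G M act h y"
  ultimately have "(g, x) \<in> germ G M act h y" by simp
  then show "x = y \<and> agree_near g h x"
    unfolding germ_def germ_rel_def by (auto simp: agree_near_def)
next
  assume *: "x = y \<and> agree_near g h x"
  have "germ G M act k x = {(f, x) |f. f \<in> carrier G \<and> agree_near k f x}" if "k \<in> carrier G" for k
    unfolding germ_def germ_rel_def agree_near_def using that assms(3) by auto
  moreover have "agree_near g f x \<longleftrightarrow> agree_near h f x" for f
    using * agree_near_trans agree_near_sym by blast
  ultimately show "germ G M act g x = germ G M act h y" using assms * by simp
qed

text \<open>
  Openness in a form that refers to single germs, as products and inverses of sets of germs do; it is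
  therefore easily seen to be inherited by them.
\<close>

definition germ_open :: "('g \<times> 'x) set set \<Rightarrow> bool" where
  "germ_open A \<longleftrightarrow> (\<forall>g\<in>carrier G. \<forall>x\<in>topspace M. germ G M act g x \<in> A \<longrightarrow>
     (\<exists>U. openin M U \<and> x \<in> U \<and> (\<forall>y\<in>U. germ G M act g y \<in> A)))"

lemma germ_openD:
  assumes "germ_open A" "g \<in> carrier G" "x \<in> topspace M" "germ G M act g x \<in> A"
  obtains U where "openin M U" "x \<in> U" "\<And>y. y \<in> U \<Longrightarrow> germ G M act g y \<in> A"
proof -
  from assms have "\<exists>U. openin M U \<and> x \<in> U \<and> (\<forall>y\<in>U. germ G M act g y \<in> A)"
    by (simp add: germ_open_def)
  then show thesis using that by auto
qed

lemma agree_near_imp_germ_eq_near: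
  assumes "g \<in> carrier G" "h \<in> carrier G" "agree_near g h x"
  obtains U where "openin M U" "x \<in> U" "\<And>y. y \<in> U \<Longrightarrow> germ G M act g y = germ G M act h y"
proof -
  obtain U where U: "openin M U" "x \<in> U" "\<forall>y\<in>U. act g y = act h y"
    using assms(3) unfolding agree_near_def by blast
  have "germ G M act g y = germ G M act h y" if "y \<in> U" for y
  proof -
    have "y \<in> topspace M" using U(1) that openin_subset by blast
    moreover have "agree_near g h y" using U that unfolding agree_near_def by blast
    ultimately show ?thesis using germ_eq_iff[OF assms(1,2)] by blast
  qed
  then show thesis by (rule that[OF U(1,2)])
qed

lemma germ_open_union:
  assumes A: "germ_open A" and B: "germ_open B"
  shows "germ_open (A \<union> B)"
  unfolding germ_open_def
proof (intro ballI impI)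
  fix g x assume gx: "g \<in> carrier G" "x \<in> topspace M" "germ G M act g x \<in> A \<union> B"
  then consider "germ G M act g x \<in> A" | "germ G M act g x \<in> B" by blast
  then show "\<exists>U. openin M U \<and> x \<in> U \<and> (\<forall>y\<in>U. germ G M act g y \<in> A \<union> B)"
  proof cases
    case 1
    then obtain U where "openin M U" "x \<in> U" "\<And>y. y \<in> U \<Longrightarrow> germ G M act g y \<in> A"
      using germ_openD[OF A gx(1,2)] by blast
    then show ?thesis by (intro exI[of _ U]) simp
  next
    case 2
    then obtain U where "openin M U" "x \<in> U" "\<And>y. y \<in> U \<Longrightarrow> germ G M act g y \<in> B"
      using germ_openD[OF B gx(1,2)] by blast
    then show ?thesis by (intro exI[of _ U]) simp
  qed
qed

lemma germ_open_if_openin: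
  assumes "openin (germ_topology G M act) A"
  shows "germ_open A"
proof -
  have "generate_topology_on {germ G M act g ` U |g U. g \<in> carrier G \<and> openin M U} A"
    using assms unfolding germ_topology_def by (rule openin_topology_generated_by)
  then show ?thesis
  proof induction
    case Empty
    show ?case by (simp add: germ_open_def)
  next
    case (Int A B)
    show ?case
      unfolding germ_open_def
    proof (intro ballI impI)
      fix g x assume gx: "g \<in> carrier G" "x \<in> topspace M" "germ G M act g x \<in> A \<inter> B"
      obtain U where U: "openin M U" "x \<in> U" "\<And>y. y \<in> U \<Longrightarrow> germ G M act g y \<in> A"
        using germ_openD[OF Int.IH(1) gx(1,2)] gx(3) by blast
      obtain W where W: "openin M W" "x \<in> W" "\<And>y. y \<in> W \<Longrightarrow> germ G M act g y \<in> B"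
        using germ_openD[OF Int.IH(2) gx(1,2)] gx(3) by blast
      show "\<exists>U. openin M U \<and> x \<in> U \<and> (\<forall>y\<in>U. germ G M act g y \<in> A \<inter> B)"
        using U W by (intro exI[of _ "U \<inter> W"]) auto
    qed
  next
    case (UN K)
    show ?case
      unfolding germ_open_def
    proof (intro ballI impI)
      fix g x assume gx: "g \<in> carrier G" "x \<in> topspace M" "germ G M act g x \<in> \<Union>K"
      then obtain A where A: "A \<in> K" "germ G M act g x \<in> A" by blast
      obtain U where "openin M U" "x \<in> U" "\<And>y. y \<in> U \<Longrightarrow> germ G M act g y \<in> A"
        using germ_openD[OF UN.IH[OF A(1)] gx(1,2) A(2)] by blast
      then show "\<exists>U. openin M U \<and> x \<in> U \<and> (\<forall>y\<in>U. germ G M act g y \<in> \<Union>K)"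
        using A(1) by blast
    qed
  next
    case (Basis A)
    then obtain h U where hU: "A = germ G M act h ` U" "h \<in> carrier G" "openin M U" by blast
    show ?case
      unfolding germ_open_def
    proof (intro ballI impI)
      fix g x assume gx: "g \<in> carrier G" "x \<in> topspace M" "germ G M act g x \<in> A"
      then obtain z where z: "z \<in> U" "germ G M act g x = germ G M act h z" using hU by blast
      then have "x = z" "agree_near g h x" using germ_eq_iff[OF gx(1) hU(2) gx(2)] by blast+
      moreover obtain W where W: "openin M W" "x \<in> W"
        "\<And>y. y \<in> W \<Longrightarrow> germ G M act g y = germ G M act h y"
        using agree_near_imp_germ_eq_near[OF gx(1) hU(2) \<open>agree_near g h x\<close>] by blast
      ultimately show "\<exists>U. openin M U \<and> x \<in> U \<and> (\<forall>y\<in>U. germ G M act g y \<in> A)"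
        using z hU by (intro exI[of _ "U \<inter> W"]) auto
    qed
  qed
qed

lemma germ_open_units: "germ_open (germ_units G M act)"
  unfolding germ_open_def
proof (intro ballI impI)
  fix g x assume gx: "g \<in> carrier G" "x \<in> topspace M" "germ G M act g x \<in> germ_units G M act"
  then have "agree_near g \<one> x" using germ_eq_iff[OF gx(1) one_closed gx(2)] by (auto simp: germ_units_def)
  then obtain U where U: "openin M U" "x \<in> U" "\<And>y. y \<in> U \<Longrightarrow> germ G M act g y = germ G M act \<one> y"
    using agree_near_imp_germ_eq_near[OF gx(1) one_closed] by blast
  then show "\<exists>U. openin M U \<and> x \<in> U \<and> (\<forall>y\<in>U. germ G M act g y \<in> germ_units G M act)"
    using openin_subset[OF U(1)] by (intro exI[of _ U]) (auto simp: germ_units_def)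
qed

lemma germ_open_mult:
  assumes A: "germ_open A" and B: "germ_open B"
  shows "germ_open (germ_mult G M act A B)"
  unfolding germ_open_def
proof (intro ballI impI)
  fix g x assume gx: "g \<in> carrier G" "x \<in> topspace M" "germ G M act g x \<in> germ_mult G M act A B"
  then obtain g2 g1 z where g21: "g2 \<in> carrier G" "g1 \<in> carrier G"
    and z: "germ G M act g x = germ G M act (g2 \<otimes> g1) z" "germ G M act g2 (act g1 z) \<in> A"
      "germ G M act g1 z \<in> B"
    unfolding germ_mult_def by blast
  have xz: "x = z" and agree: "agree_near g (g2 \<otimes> g1) x"
    using z(1) germ_eq_iff[OF gx(1) m_closed[OF g21] gx(2)] by blast+
  obtain U where U: "openin M U" "act g1 x \<in> U" "\<And>y. y \<in> U \<Longrightarrow> germ G M act g2 y \<in> A"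
    using germ_openD[OF A g21(1) act_in[OF g21(2) gx(2)]] z(2) xz by blast
  obtain W where W: "openin M W" "x \<in> W" "\<And>y. y \<in> W \<Longrightarrow> germ G M act g1 y \<in> B"
    using germ_openD[OF B g21(2) gx(2)] z(3) xz by blast
  obtain Z where Z: "openin M Z" "x \<in> Z"
    "\<And>y. y \<in> Z \<Longrightarrow> germ G M act g y = germ G M act (g2 \<otimes> g1) y"
    using agree_near_imp_germ_eq_near[OF gx(1) m_closed[OF g21] agree] by blast
  let ?P = "{y \<in> topspace M. act g1 y \<in> U}"
  have "openin M ?P" using openin_continuous_map_preimage[OF act_continuous[OF g21(2)] U(1)] .
  then have "openin M (?P \<inter> W \<inter> Z)" using W(1) Z(1) by blast
  moreover have "germ G M act g y \<in> germ_mult G M act A B" if y: "y \<in> ?P \<inter> W \<inter> Z" for y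
    using y U(3) W(3) Z(3) g21 unfolding germ_mult_def by blast
  ultimately show "\<exists>U. openin M U \<and> x \<in> U \<and> (\<forall>y\<in>U. germ G M act g y \<in> germ_mult G M act A B)"
    using gx(2) U(2) W(2) Z(2) by (intro exI[of _ "?P \<inter> W \<inter> Z"]) blast
qed

lemma germ_open_inv:
  assumes A: "germ_open A"
  shows "germ_open (germ_inv G M act A)"
  unfolding germ_open_def
proof (intro ballI impI)
  fix h x assume hx: "h \<in> carrier G" "x \<in> topspace M" "germ G M act h x \<in> germ_inv G M act A"
  then obtain g z where g: "g \<in> carrier G" and z: "z \<in> topspace M" "germ G M act g z \<in> A"
    and eq: "germ G M act h x = germ G M act (inv g) (act g z)"
    unfolding germ_inv_def by blast
  have xz: "x = act g z" and agree: "agree_near h (inv g) x"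
    using eq germ_eq_iff[OF hx(1) inv_closed[OF g] hx(2)] by blast+
  obtain U where U: "openin M U" "z \<in> U" "\<And>y. y \<in> U \<Longrightarrow> germ G M act g y \<in> A"
    using germ_openD[OF A g z] by blast
  obtain Z where Z: "openin M Z" "x \<in> Z"
    "\<And>y. y \<in> Z \<Longrightarrow> germ G M act h y = germ G M act (inv g) y"
    using agree_near_imp_germ_eq_near[OF hx(1) inv_closed[OF g] agree] by blast
  let ?P = "{y \<in> topspace M. act (inv g) y \<in> U}"
  have "openin M ?P"
    using openin_continuous_map_preimage[OF act_continuous[OF inv_closed[OF g]] U(1)] .
  then have "openin M (?P \<inter> Z)" using Z(1) by blast
  moreover have "x \<in> ?P \<inter> Z" using hx(2) Z(2) U(2) xz act_inv[OF g z(1)] by simp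
  moreover have "germ G M act h y \<in> germ_inv G M act A" if y: "y \<in> ?P \<inter> Z" for y
  proof -
    have yM: "y \<in> topspace M" and yU: "act (inv g) y \<in> U" using y by auto
    have "germ G M act h y = germ G M act (inv g) (act g (act (inv g) y))"
      using Z(3) y act_inv'[OF g yM] by simp
    then show ?thesis
      using U(3)[OF yU] g act_in[OF inv_closed[OF g] yM] unfolding germ_inv_def by blast
  qed
  ultimately show "\<exists>U. openin M U \<and> x \<in> U \<and> (\<forall>y\<in>U. germ G M act h y \<in> germ_inv G M act A)"
    by (intro exI[of _ "?P \<inter> Z"]) blast
qed

lemma germ_open_power: "germ_open A \<Longrightarrow> germ_open (germ_power G M act A n)"
  by (induction n) (simp_all add: germ_open_units germ_open_mult)

text \<open>
  A finite set of group elements that carries all germs of a set bounds the number of its germs at each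
  point, uniformly in the point.  This property passes to products and inverses.
\<close>

definition carried_by :: "('g \<times> 'x) set set \<Rightarrow> 'g set \<Rightarrow> bool" where
  "carried_by A E \<longleftrightarrow> E \<subseteq> carrier G \<and> (\<forall>z\<in>A. \<exists>h\<in>E. \<exists>x\<in>topspace M. z = germ G M act h x)"

text \<open>
  The germs of a single group element form an open set, and these sets cover the groupoid, so finitely
  many of them cover a compact set.
\<close>

lemma carried_by_compact:
  assumes S: "compactin (germ_topology G M act) S"
  shows "\<exists>E. finite E \<and> carried_by S E"
proof -
  let ?C = "(\<lambda>g. germ G M act g ` topspace M) ` carrier G"
  have "openin (germ_topology G M act) U" if "U \<in> ?C" for U
    unfolding germ_topology_def openin_topology_generated_by_iff
    using that by (intro generate_topology_on.Basis) auto
  moreover have "S \<subseteq> \<Union>?C"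
  proof -
    have "topspace (germ_topology G M act) \<subseteq> \<Union>?C"
      unfolding germ_topology_def topology_generated_by_topspace
      using openin_subset by fastforce
    then show ?thesis using compactin_subset_topspace[OF S] by blast
  qed
  ultimately obtain \<F> where F: "finite \<F>" "\<F> \<subseteq> ?C" "S \<subseteq> \<Union>\<F>"
    using compactinD[OF S] by meson
  then obtain E where E: "E \<subseteq> carrier G" "finite E" "\<F> = (\<lambda>g. germ G M act g ` topspace M) ` E"
    using finite_subset_image by meson
  then have "carried_by S E" using F(3) unfolding carried_by_def by blast
  then show ?thesis using E by blast
qed

lemma carried_by_union: "carried_by A E \<Longrightarrow> carried_by B F \<Longrightarrow> carried_by (A \<union> B) (E \<union> F)"
  by (simp add: carried_by_def ball_Un bex_Un)

lemma carried_by_units: "carried_by (germ_units G M act) {\<one>}"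
  unfolding carried_by_def germ_units_def by auto

lemma carried_by_mult:
  assumes A: "carried_by A E" and B: "carried_by B F"
  shows "carried_by (germ_mult G M act A B) ((\<lambda>(e, f). e \<otimes> f) ` (E \<times> F))"
  unfolding carried_by_def
proof (intro conjI ballI)
  show "(\<lambda>(e, f). e \<otimes> f) ` (E \<times> F) \<subseteq> carrier G"
    using A B unfolding carried_by_def by auto
  fix z assume "z \<in> germ_mult G M act A B"
  then obtain g2 g1 x where g: "g2 \<in> carrier G" "g1 \<in> carrier G" and x: "x \<in> topspace M"
    and z: "z = germ G M act (g2 \<otimes> g1) x"
    and in_A: "germ G M act g2 (act g1 x) \<in> A" and in_B: "germ G M act g1 x \<in> B"
    unfolding germ_mult_def by blast
  obtain e u where e: "e \<in> E" "e \<in> carrier G" and eu: "germ G M act g2 (act g1 x) = germ G M act e u"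
    using A in_A unfolding carried_by_def by blast
  obtain f v where f: "f \<in> F" "f \<in> carrier G" and fv: "germ G M act g1 x = germ G M act f v"
    using B in_B unfolding carried_by_def by blast
  have "agree_near g2 e (act g1 x)"
    using eu germ_eq_iff[OF g(1) e(2) act_in[OF g(2) x]] by blast
  moreover have "agree_near g1 f x" using fv germ_eq_iff[OF g(2) f(2) x] by blast
  ultimately have "agree_near (g2 \<otimes> g1) (e \<otimes> f) x"
    using agree_near_mult[OF g(1) e(2) g(2) f(2) x] by blast
  then have "z = germ G M act (e \<otimes> f) x"
    using z germ_eq_iff[OF m_closed[OF g] m_closed[OF e(2) f(2)] x] by blast
  then show "\<exists>h\<in>(\<lambda>(e, f). e \<otimes> f) ` (E \<times> F). \<exists>x\<in>topspace M. z = germ G M act h x"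
    using e(1) f(1) x by blast
qed

lemma carried_by_inv:
  assumes A: "carried_by A E"
  shows "carried_by (germ_inv G M act A) (m_inv G ` E)"
  unfolding carried_by_def
proof (intro conjI ballI)
  show "m_inv G ` E \<subseteq> carrier G" using A unfolding carried_by_def by auto
  fix z assume "z \<in> germ_inv G M act A"
  then obtain g x where g: "g \<in> carrier G" and x: "x \<in> topspace M"
    and z: "z = germ G M act (inv g) (act g x)" and in_A: "germ G M act g x \<in> A"
    unfolding germ_inv_def by blast
  obtain e u where e: "e \<in> E" "e \<in> carrier G" and eu: "germ G M act g x = germ G M act e u"
    using A in_A unfolding carried_by_def by blast
  have "agree_near g e x" using eu germ_eq_iff[OF g e(2) x] by blast
  then have "agree_near (inv g) (inv e) (act g x)" using agree_near_inv[OF g e(2) x] by blast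
  then have "z = germ G M act (inv e) (act g x)"
    using z germ_eq_iff[OF inv_closed[OF g] inv_closed[OF e(2)] act_in[OF g x]] by blast
  then show "\<exists>h\<in>m_inv G ` E. \<exists>x\<in>topspace M. z = germ G M act h x"
    using e(1) act_in[OF g x] by blast
qed

lemma carried_by_power:
  assumes "finite E" "carried_by A E"
  shows "\<exists>F. finite F \<and> carried_by (germ_power G M act A n) F"
proof (induction n)
  case 0
  show ?case using carried_by_units by auto
next
  case (Suc n)
  then obtain F where "finite F" "carried_by (germ_power G M act A n) F" by blast
  then show ?case using carried_by_mult[OF assms(2)] assms(1)
    by (intro exI[of _ "(\<lambda>(e, f). e \<otimes> f) ` (E \<times> F)"]) simp
qed

text \<open>
  The growth function is a cardinality, and the cardinality of an infinite set is \<open>0\<close>.  A lower bound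
  for the growth therefore needs the finiteness of the balls.
\<close>

lemma finite_germ_ball:
  assumes S: "compactin (germ_topology G M act) S"
  shows "finite (germ_origin G M act x \<inter>
    (\<Union>k\<le>n. germ_power G M act (S \<union> germ_inv G M act S) k))" (is "finite (_ \<inter> ?U)")
proof -
  obtain E where "finite E" "carried_by S E" using carried_by_compact[OF S] by blast
  then have "carried_by (S \<union> germ_inv G M act S) (E \<union> m_inv G ` E)" "finite (E \<union> m_inv G ` E)"
    using carried_by_union carried_by_inv by simp_all
  then have "\<exists>F. finite F \<and> carried_by (germ_power G M act (S \<union> germ_inv G M act S) k) F" for k
    using carried_by_power by blast
  then obtain F where F: "\<And>k. finite (F k)"
    "\<And>k. carried_by (germ_power G M act (S \<union> germ_inv G M act S) k) (F k)" by metis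
  have "germ_origin G M act x \<inter> ?U \<subseteq> (\<lambda>h. germ G M act h x) ` (\<Union>k\<le>n. F k)"
  proof
    fix z assume z: "z \<in> germ_origin G M act x \<inter> ?U"
    then obtain g where g: "g \<in> carrier G" "z = germ G M act g x"
      unfolding germ_origin_def by blast
    obtain k where k: "k \<le> n" "z \<in> germ_power G M act (S \<union> germ_inv G M act S) k" using z by blast
    then obtain h y where h: "h \<in> F k" "h \<in> carrier G" "y \<in> topspace M" "z = germ G M act h y"
      using F(2)[of k] unfolding carried_by_def by blast
    then have "y = x" using g germ_eq_iff[of h g y x] by simp
    then show "z \<in> (\<lambda>h. germ G M act h x) ` (\<Union>k\<le>n. F k)" using h k by blast
  qed
  moreover have "finite ((\<lambda>h. germ G M act h x) ` (\<Union>k\<le>n. F k))" using F(1) by blast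
  ultimately show ?thesis by (rule finite_subset)
qed

lemma germ_power_mult:
  assumes "g \<in> carrier G" "h \<in> carrier G" "x \<in> topspace M"
    and "germ G M act g (act h x) \<in> germ_power G M act A j"
    and "germ G M act h x \<in> germ_power G M act A k"
  shows "germ G M act (g \<otimes> h) x \<in> germ_power G M act A (j + k)"
  using assms(1,4)
proof (induction j arbitrary: g)
  case 0
  then have "agree_near g \<one> (act h x)"
    using germ_eq_iff[OF 0(1) one_closed act_in[OF assms(2,3)]] by (auto simp: germ_units_def)
  then have "agree_near (g \<otimes> h) (\<one> \<otimes> h) x"
    using agree_near_mult[OF 0(1) one_closed assms(2,2,3)] agree_near_refl[OF assms(3)] by blast
  then have "germ G M act (g \<otimes> h) x = germ G M act h x"
    using 0(1) assms(2,3) germ_eq_iff by simp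
  then show ?case using assms(5) by simp
next
  case (Suc j)
  then obtain g2 g1 y where g: "g2 \<in> carrier G" "g1 \<in> carrier G"
    and eq: "germ G M act g (act h x) = germ G M act (g2 \<otimes> g1) y"
    and in_A: "germ G M act g2 (act g1 y) \<in> A"
    and in_power: "germ G M act g1 y \<in> germ_power G M act A j"
    by (auto simp: germ_mult_def)
  have y: "act h x = y" and agree: "agree_near g (g2 \<otimes> g1) (act h x)"
    using eq germ_eq_iff[OF Suc.prems(1) m_closed[OF g] act_in[OF assms(2,3)]] by blast+
  have "germ G M act (g1 \<otimes> h) x \<in> germ_power G M act A (j + k)"
    using Suc.IH[OF g(2)] in_power y by simp
  moreover have "germ G M act g2 (act (g1 \<otimes> h) x) \<in> A"
    using in_A y g assms(2,3) by (simp add: act_mult)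
  ultimately have "germ G M act (g2 \<otimes> (g1 \<otimes> h)) x \<in> germ_power G M act A (Suc j + k)"
    using g assms(2,3) unfolding add_Suc germ_power.simps germ_mult_def by blast
  moreover have "germ G M act (g \<otimes> h) x = germ G M act (g2 \<otimes> g1 \<otimes> h) x"
    using germ_eq_iff agree_near_mult[OF Suc.prems(1) m_closed[OF g] assms(2,2,3) agree]
      agree_near_refl[OF assms(3)] Suc.prems(1) g assms(2,3) by simp
  ultimately show ?case using g assms(2) by (simp add: m_assoc)
qed

text \<open>
  The germs of one element need a bounded number of factors: a germ in some power of the generating set
  has a neighbourhood of germs in the same power, and finitely many of these neighbourhoods suffice.
\<close>

lemma germ_power_bounded:
  assumes compact: "compact_space M" and gen: "open_compact_generating G M act S" and a: "a \<in> carrier G"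
  shows "\<exists>N. \<forall>x\<in>topspace M. \<exists>k\<le>N. germ G M act a x \<in> germ_power G M act (S \<union> germ_inv G M act S) k"
    (is "\<exists>N. \<forall>x\<in>_. \<exists>k\<le>N. ?P k x")
proof -
  have "germ_open S" using gen germ_open_if_openin by (simp add: open_compact_generating_def)
  then have open_power: "germ_open (germ_power G M act (S \<union> germ_inv G M act S) k)" for k
    by (intro germ_open_power germ_open_union germ_open_inv)
  have "\<exists>U k. openin M U \<and> x \<in> U \<and> (\<forall>y\<in>U. ?P k y)" if x: "x \<in> topspace M" for x
  proof -
    have "germ G M act a x \<in> germs G M act"
      unfolding germs_def germ_def using a x by (intro quotientI) simp
    then obtain k where "?P k x" using gen unfolding open_compact_generating_def by blast
    then have "\<exists>U. openin M U \<and> x \<in> U \<and> (\<forall>y\<in>U. ?P k y)"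
      using open_power[of k] a x by (simp add: germ_open_def)
    then show ?thesis by blast
  qed
  then obtain U k where Uk: "\<And>x. x \<in> topspace M \<Longrightarrow> openin M (U x) \<and> x \<in> U x \<and> (\<forall>y\<in>U x. ?P (k x) y)"
    by metis
  have "\<And>X. X \<in> U ` topspace M \<Longrightarrow> openin M X" "topspace M \<subseteq> \<Union> (U ` topspace M)"
    using Uk by auto
  then obtain \<F> where "finite \<F>" "\<F> \<subseteq> U ` topspace M" "topspace M \<subseteq> \<Union>\<F>"
    using compactinD[OF compact[unfolded compact_space_def]] by metis
  moreover from this obtain J where J: "J \<subseteq> topspace M" "finite J" "\<F> = U ` J"
    using finite_subset_image by meson
  ultimately have cover: "topspace M \<subseteq> (\<Union>i\<in>J. U i)" by blast
  show ?thesis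
  proof (rule exI[of _ "\<Sum>i\<in>J. k i"], rule ballI)
    fix x assume "x \<in> topspace M"
    then obtain i where "i \<in> J" "x \<in> U i" using cover by blast
    moreover have "k i \<le> (\<Sum>i\<in>J. k i)" using J(2) \<open>i \<in> J\<close> by (intro member_le_sum) auto
    ultimately show "\<exists>m\<le>(\<Sum>i\<in>J. k i). ?P m x" using Uk J(1) by blast
  qed
qed

lemma positive_word_closed:
  "a \<in> carrier G \<Longrightarrow> b \<in> carrier G \<Longrightarrow> word_value G (positive_word a b u) \<in> carrier G"
  by (rule word_value_closed) (auto simp: positive_word_def)

text \<open>
  The \<open>2\<^sup>n\<close> positive words of length \<open>n\<close> have different germs at \<open>x\<close>, all within the ball of radius \<open>N n\<close>,
  where \<open>N\<close> bounds the number of factors that the germs of \<open>a\<close> and \<open>b\<close> need.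
\<close>

proposition free_semigroup_germs_imp_exponential_growth:
  assumes compact: "compact_space M" and gen: "open_compact_generating G M act S"
    and ab: "a \<in> carrier G" "b \<in> carrier G" and x: "x \<in> topspace M"
    and free: "\<And>u v. agree_near (word_value G (positive_word a b u)) (word_value G (positive_word a b v)) x \<Longrightarrow> u = v"
  shows "\<exists>N>0. \<forall>n. 2 ^ n \<le> germ_growth G M act S x (N * n)"
proof -
  let ?P = "germ_power G M act (S \<union> germ_inv G M act S)"
  obtain N1 N2 where N1: "\<forall>x\<in>topspace M. \<exists>k\<le>N1. germ G M act a x \<in> ?P k"
    and N2: "\<forall>x\<in>topspace M. \<exists>k\<le>N2. germ G M act b x \<in> ?P k"
    using germ_power_bounded[OF compact gen] ab by metis
  \<comment> \<open>The successor makes \<open>N\<close> positive, as is needed to divide by it.\<close>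
  define N where "N = Suc (N1 + N2)"
  have letter: "\<exists>k\<le>N. germ G M act (if c then a else b) y \<in> ?P k" if y: "y \<in> topspace M" for c y
  proof -
    obtain k1 where "k1 \<le> N1" "germ G M act a y \<in> ?P k1" using bspec[OF N1 y] by blast
    moreover obtain k2 where "k2 \<le> N2" "germ G M act b y \<in> ?P k2" using bspec[OF N2 y] by blast
    ultimately show ?thesis by (intro exI[of _ "if c then k1 else k2"]) (simp add: N_def)
  qed
  have word: "\<exists>k\<le>N * length u. germ G M act (word_value G (positive_word a b u)) x \<in> ?P k" for u
  proof (induction u)
    case Nil
    show ?case using x by (auto simp: positive_word_def germ_units_def)
  next
    case (Cons c u)
    let ?c = "if c then a else b"
    obtain k where k: "k \<le> N * length u" "germ G M act (word_value G (positive_word a b u)) x \<in> ?P k"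
      using Cons by blast
    obtain j where j: "j \<le> N" "germ G M act ?c (act (word_value G (positive_word a b u)) x) \<in> ?P j"
      using letter act_in positive_word_closed ab x by meson
    have "germ G M act (?c \<otimes> word_value G (positive_word a b u)) x \<in> ?P (j + k)"
      using germ_power_mult[OF _ _ x j(2) k(2)] ab positive_word_closed by simp
    then show ?case using j k by (intro exI[of _ "j + k"]) (simp add: word_value_positive_Cons)
  qed
  have "2 ^ n \<le> germ_growth G M act S x (N * n)" for n
  proof -
    let ?W = "{u :: bool list. length u = n}" and ?f = "\<lambda>u. germ G M act (word_value G (positive_word a b u)) x"
    have "inj_on ?f ?W"
      using free germ_eq_iff[OF positive_word_closed[OF ab] positive_word_closed[OF ab] x]
      by (intro inj_onI) blast
    moreover have "card ?W = 2 ^ n"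
      using card_lists_length_eq[of "UNIV :: bool set" n] by simp
    ultimately have "2 ^ n = card (?f ` ?W)" by (simp add: card_image)
    also have "\<dots> \<le> germ_growth G M act S x (N * n)"
      unfolding germ_growth_def
    proof (rule card_mono)
      show "?f ` ?W \<subseteq> germ_origin G M act x \<inter> (\<Union>k\<le>N * n. ?P k)"
        using word positive_word_closed[OF ab] unfolding germ_origin_def by fastforce
    qed (use gen finite_germ_ball in \<open>simp add: open_compact_generating_def\<close>)
    finally show ?thesis .
  qed
  then show ?thesis by (intro exI[of _ N]) (simp add: N_def)
qed

end

lemma not_subexponential_if_power_bound:
  assumes N: "0 < N" and f: "\<And>n. 2 ^ n \<le> f (N * n)"
  shows "\<not> subexponential_growth f"
proof
  assume "subexponential_growth f"
  then have lim: "(\<lambda>n. 1 / real n * ln (real (f n))) \<longlonglongrightarrow> 0"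
    by (simp add: subexponential_growth_def)
  have "filterlim (\<lambda>n. N * n) sequentially sequentially"
    using N by (intro filterlim_subseq) (simp add: strict_mono_def)
  from filterlim_compose[OF lim this]
  have lim': "(\<lambda>n. 1 / real (N * n) * ln (real (f (N * n)))) \<longlonglongrightarrow> 0" .
  have "ln 2 / real N \<le> 0"
  proof (rule LIMSEQ_le_const[OF lim'], intro exI[of _ 1] allI impI)
    fix n :: nat assume n: "1 \<le> n"
    have "ln 2 / real N = 1 / real (N * n) * (real n * ln 2)" using N n by simp
    also have "real n * ln 2 = ln (2 ^ n)" by (simp add: ln_realpow)
    also have "\<dots> \<le> ln (real (f (N * n)))"
    proof -
      have "real (2 ^ n) \<le> real (f (N * n))" using f of_nat_mono by blast
      then show ?thesis by (intro ln_mono) (auto intro: order.strict_trans2[of 0 "2 ^ n"])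
    qed
    finally show "ln 2 / real N \<le> 1 / real (N * n) * ln (real (f (N * n)))"
      by (simp add: divide_right_mono)
  qed
  then show False using N by (simp add: divide_le_0_iff)
qed

section \<open>The boundary of a locally finite tree\<close>

lemma topspace_boundary_topology:
  assumes "r \<in> V"
  shows "topspace (boundary_topology V adj r) = boundary adj r"
proof -
  have "x \<in> \<Union> {{x \<in> boundary adj r. v \<in> range x} |v. v \<in> V}" if "x \<in> boundary adj r" for x
  proof -
    have "r \<in> range x" using that by (metis (mono_tags, lifting) boundary_def mem_Collect_eq rangeI)
    then show ?thesis using that assms by blast
  qed
  then show ?thesis unfolding boundary_topology_def topology_generated_by_topspace by blast
qed

text \<open>
  For finite \<open>X\<close>, these sets form a base of the topology.  Whether an automorphism preserves such a
  set can be read off its action on the finitely many vertices in \<open>X\<close>.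
\<close>

definition passing_through :: "('v \<Rightarrow> 'v \<Rightarrow> bool) \<Rightarrow> 'v \<Rightarrow> 'v set \<Rightarrow> (nat \<Rightarrow> 'v) set" where
  "passing_through adj r X = {x \<in> boundary adj r. X \<subseteq> range x}"

lemma openin_passing_through:
  assumes "r \<in> V" "finite X" "X \<subseteq> V"
  shows "openin (boundary_topology V adj r) (passing_through adj r X)"
  using assms(2,3)
proof (induction X)
  case empty
  then show ?case
    using openin_topspace[of "boundary_topology V adj r"] topspace_boundary_topology[OF assms(1), of adj]
    by (simp add: passing_through_def)
next
  case (insert v X)
  have "openin (boundary_topology V adj r) {x \<in> boundary adj r. v \<in> range x}"
    unfolding boundary_topology_def openin_topology_generated_by_iff
    using insert.prems by (intro generate_topology_on.Basis) auto
  moreover have "passing_through adj r (insert v X) =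
      {x \<in> boundary adj r. v \<in> range x} \<inter> passing_through adj r X"
    by (auto simp: passing_through_def)
  ultimately show ?case using insert by auto
qed

lemma passing_through_base:
  assumes U: "openin (boundary_topology V adj r) U" and x: "x \<in> U"
  shows "\<exists>X. finite X \<and> X \<subseteq> range x \<and> passing_through adj r X \<subseteq> U"
proof -
  have "generate_topology_on {{x \<in> boundary adj r. v \<in> range x} |v. v \<in> V} U"
    using U unfolding boundary_topology_def by (rule openin_topology_generated_by)
  then show ?thesis
    using x
  proof induction
    case (Int A B)
    then obtain X Y where "finite X" "X \<subseteq> range x" "passing_through adj r X \<subseteq> A"
      "finite Y" "Y \<subseteq> range x" "passing_through adj r Y \<subseteq> B" by blast
    then show ?case
      by (intro exI[of _ "X \<union> Y"]) (auto simp: passing_through_def)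
  next
    case (UN K)
    then show ?case by (meson Union_iff Union_upper order_trans)
  next
    case (Basis A)
    then obtain v where "A = {x \<in> boundary adj r. v \<in> range x}" by blast
    then show ?case using Basis.prems
      by (intro exI[of _ "{v}"]) (auto simp: passing_through_def)
  qed simp
qed

context rooted_tree
begin

lemma boundary_in_V: "x \<in> boundary adj r \<Longrightarrow> x n \<in> V"
  using adj_in_V unfolding boundary_def by blast

text \<open>
  By local finiteness a cylinder splits into finitely many cylinders of the next length, which is what
  the compactness argument needs.
\<close>

definition prefix_cylinder :: "(nat \<Rightarrow> 'v) \<Rightarrow> nat \<Rightarrow> (nat \<Rightarrow> 'v) set" where
  "prefix_cylinder x n = {y \<in> boundary adj r. \<forall>i\<le>n. y i = x i}"

lemma group_tree_aut: "group (tree_aut V adj r)"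
proof -
  let ?A = "{g \<in> Bij V. g r = r \<and> (\<forall>u\<in>V. \<forall>v\<in>V. adj (g u) (g v) \<longleftrightarrow> adj u v)}"
  interpret B: group "BijGroup V" by (rule group_BijGroup)
  have "subgroup ?A (BijGroup V)"
  proof (rule B.subgroupI)
    show "?A \<subseteq> carrier (BijGroup V)" by (auto simp: BijGroup_def)
    have "(\<lambda>v\<in>V. v) \<in> ?A" using root_in_V id_Bij by simp
    then show "?A \<noteq> {}" by blast
    show "inv\<^bsub>BijGroup V\<^esub> g \<in> ?A" if g: "g \<in> ?A" for g
    proof -
      have gB: "bij_betw g V V" using g by (simp add: Bij_def)
      have in_V: "inv_into V g v \<in> V" and g_inv: "g (inv_into V g v) = v" if "v \<in> V" for v
        using that gB by (simp_all add: bij_betw_def inv_into_into f_inv_into_f)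
      have "inv_into V g r = r"
        using g inv_into_f_f[OF bij_betw_imp_inj_on[OF gB] root_in_V] by simp
      moreover have "adj (inv_into V g u) (inv_into V g v) \<longleftrightarrow> adj u v" if "u \<in> V" "v \<in> V" for u v
      proof -
        have "adj (g (inv_into V g u)) (g (inv_into V g v)) \<longleftrightarrow> adj (inv_into V g u) (inv_into V g v)"
          using g in_V[OF that(1)] in_V[OF that(2)] by blast
        then show ?thesis using g_inv[OF that(1)] g_inv[OF that(2)] by simp
      qed
      ultimately show ?thesis
        using g root_in_V restrict_inv_into_Bij[of g V] by (simp add: inv_BijGroup)
    qed
    show "g \<otimes>\<^bsub>BijGroup V\<^esub> h \<in> ?A" if "g \<in> ?A" "h \<in> ?A" for g h
    proof -
      have "h v \<in> V" if "v \<in> V" for v using \<open>h \<in> ?A\<close> that Bij_imp_funcset by auto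
      then show ?thesis
        using that root_in_V compose_Bij[of g V h] by (simp add: BijGroup_def compose_def)
    qed
  qed
  then show ?thesis unfolding tree_aut_def by (rule B.subgroup_imp_group)
qed

lemma tree_aut_carrier:
  "g \<in> carrier (tree_aut V adj r) \<longleftrightarrow>
    g \<in> Bij V \<and> g r = r \<and> (\<forall>u\<in>V. \<forall>v\<in>V. adj (g u) (g v) \<longleftrightarrow> adj u v)"
  by (simp add: tree_aut_def)

lemma tree_aut_in_V: "g \<in> carrier (tree_aut V adj r) \<Longrightarrow> v \<in> V \<Longrightarrow> g v \<in> V"
  using Bij_imp_funcset unfolding tree_aut_carrier by blast

lemma tree_aut_inj_on: "g \<in> carrier (tree_aut V adj r) \<Longrightarrow> inj_on g V"
  by (simp add: tree_aut_carrier Bij_def bij_betw_def)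

lemma tree_aut_mult:
  "g \<in> carrier (tree_aut V adj r) \<Longrightarrow> h \<in> carrier (tree_aut V adj r) \<Longrightarrow> v \<in> V \<Longrightarrow>
    (g \<otimes>\<^bsub>tree_aut V adj r\<^esub> h) v = g (h v)"
  by (simp add: tree_aut_def BijGroup_def compose_def)

lemma tree_aut_one: "v \<in> V \<Longrightarrow> \<one>\<^bsub>tree_aut V adj r\<^esub> v = v"
  by (simp add: tree_aut_def BijGroup_def)

lemma tree_aut_boundary:
  assumes g: "g \<in> carrier (tree_aut V adj r)" and x: "x \<in> boundary adj r"
  shows "g \<circ> x \<in> boundary adj r"
proof -
  have xV: "x n \<in> V" for n using x by (rule boundary_in_V)
  have "inj (g \<circ> x)"
    using x xV tree_aut_inj_on[OF g] by (auto simp: boundary_def inj_on_def)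
  then show ?thesis
    using g x xV unfolding tree_aut_carrier boundary_def by auto
qed

lemma continuous_tree_aut:
  assumes g: "g \<in> carrier (tree_aut V adj r)"
  shows "continuous_map (boundary_topology V adj r) (boundary_topology V adj r) ((\<circ>) g)"
proof -
  have top: "topspace (boundary_topology V adj r) = boundary adj r"
    using root_in_V by (rule topspace_boundary_topology)
  show ?thesis
    unfolding boundary_topology_def[of V adj r]
  proof (rule continuous_on_generated_topo)
    fix U assume "U \<in> {{x \<in> boundary adj r. v \<in> range x} |v. v \<in> V}"
    then obtain v where v: "v \<in> V" and U: "U = {x \<in> boundary adj r. v \<in> range x}" by blast
    have "g ` V = V" using g by (simp add: tree_aut_carrier Bij_def bij_betw_def)
    then have "v \<in> g ` V" using v by simp
    then obtain w where w: "w \<in> V" "g w = v" by auto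
    have "v \<in> range (g \<circ> x) \<longleftrightarrow> w \<in> range x" if "x \<in> boundary adj r" for x
      using w boundary_in_V[OF that] tree_aut_inj_on[OF g] by (auto simp: inj_on_def)
    then have "(\<circ>) g -` U \<inter> boundary adj r = passing_through adj r {w}"
      using tree_aut_boundary[OF g] by (auto simp: U passing_through_def)
    then show "openin (topology_generated_by {{x \<in> boundary adj r. v \<in> range x} |v. v \<in> V})
        ((\<circ>) g -` U \<inter> topspace (topology_generated_by {{x \<in> boundary adj r. v \<in> range x} |v. v \<in> V}))"
      using openin_passing_through[of r V "{w}" adj] root_in_V w top
      by (simp add: boundary_topology_def)
  next
    show "(\<circ>) g ` topspace (topology_generated_by {{x \<in> boundary adj r. v \<in> range x} |v. v \<in> V})
        \<subseteq> \<Union> {{x \<in> boundary adj r. v \<in> range x} |v. v \<in> V}"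
    proof -
      have "\<Union> {{x \<in> boundary adj r. v \<in> range x} |v. v \<in> V} = boundary adj r"
        using top unfolding boundary_topology_def topology_generated_by_topspace .
      then show ?thesis
        unfolding topology_generated_by_topspace using tree_aut_boundary[OF g] by auto
    qed
  qed
qed

lemma topological_action_boundary:
  assumes H: "subgroup H (tree_aut V adj r)"
  shows "topological_action (tree_aut V adj r\<lparr>carrier := H\<rparr>) (boundary_topology V adj r) (\<circ>)"
proof -
  interpret T: group "tree_aut V adj r" by (rule group_tree_aut)
  have sub: "g \<in> carrier (tree_aut V adj r)" if "g \<in> H" for g
    using subgroup.mem_carrier[OF H that] .
  have top: "topspace (boundary_topology V adj r) = boundary adj r"
    using root_in_V by (rule topspace_boundary_topology)
  show ?thesis
    unfolding topological_action_def topological_action_axioms_def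
  proof (intro conjI allI impI)
    show "group (tree_aut V adj r\<lparr>carrier := H\<rparr>)" using H by (rule T.subgroup_imp_group)
  qed (auto simp: top sub continuous_tree_aut fun_eq_iff tree_aut_one tree_aut_mult boundary_in_V)
qed

end

context locally_finite_rooted_tree
begin

lemma finite_boundary_level: "finite {x n |x. x \<in> boundary adj r}"
proof (induction n)
  case 0
  have "{x 0 |x. x \<in> boundary adj r} \<subseteq> {r}" by (auto simp: boundary_def)
  then show ?case by (rule finite_subset) simp
next
  case (Suc n)
  have "{x (Suc n) |x. x \<in> boundary adj r} \<subseteq> (\<Union>v\<in>{x n |x. x \<in> boundary adj r}. {w. adj v w})"
    by (auto simp: boundary_def)
  moreover have "finite (\<Union>v\<in>{x n |x. x \<in> boundary adj r}. {w. adj v w})"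
    using Suc locally_finite boundary_in_V by blast
  ultimately show ?case by (rule finite_subset)
qed

text \<open>
  This is Koenig's lemma.  If an open cover has no finite subcover, then some initial segment of each
  length has a cylinder that cannot be covered finitely, and by local finiteness these segments can be
  chosen to extend each other.  The path that they form lies in a member of the cover, which
  contains one of the cylinders.
\<close>

lemma compact_boundary: "compact_space (boundary_topology V adj r)"
proof -
  have top: "topspace (boundary_topology V adj r) = boundary adj r"
    using root_in_V by (rule topspace_boundary_topology)
  have "\<exists>\<F>. finite \<F> \<and> \<F> \<subseteq> \<U> \<and> boundary adj r \<subseteq> \<Union>\<F>"
    if op: "\<And>U. U \<in> \<U> \<Longrightarrow> openin (boundary_topology V adj r) U" and cov: "boundary adj r \<subseteq> \<Union>\<U>" for \<U>
  proof (rule ccontr)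
    define bad where "bad X \<longleftrightarrow> \<not> (\<exists>\<F>. finite \<F> \<and> \<F> \<subseteq> \<U> \<and> X \<subseteq> \<Union>\<F>)" for X
    assume "\<not> ?thesis"
    then have bad_top: "bad (boundary adj r)" by (simp add: bad_def)
    then have "boundary adj r \<noteq> {}" by (auto simp: bad_def)
    then obtain x0 where x0: "x0 \<in> boundary adj r" by blast
    then have "prefix_cylinder x0 0 = boundary adj r"
      by (auto simp: prefix_cylinder_def boundary_def)
    then have start: "x0 \<in> boundary adj r \<and> bad (prefix_cylinder x0 0)" using x0 bad_top by simp
    have step: "\<exists>y. (y \<in> boundary adj r \<and> bad (prefix_cylinder y (Suc n))) \<and> y \<in> prefix_cylinder x n"
      if x: "x \<in> boundary adj r \<and> bad (prefix_cylinder x n)" for x n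
    proof (rule ccontr)
      assume neg: "\<not> ?thesis"
      let ?C = "\<lambda>w. {y \<in> prefix_cylinder x n. y (Suc n) = w}"
      let ?Y = "{y (Suc n) |y. y \<in> boundary adj r}"
      have covered: "\<exists>\<F>. finite \<F> \<and> \<F> \<subseteq> \<U> \<and> ?C w \<subseteq> \<Union>\<F>" for w
      proof (cases "?C w = {}")
        case False
        then obtain y where y: "y \<in> prefix_cylinder x n" "y (Suc n) = w" by blast
        then have "\<not> bad (prefix_cylinder y (Suc n))" using neg by (auto simp: prefix_cylinder_def)
        moreover have "?C w \<subseteq> prefix_cylinder y (Suc n)"
          using y by (auto simp: prefix_cylinder_def le_Suc_eq)
        ultimately show ?thesis unfolding bad_def by (meson order_trans)
      qed (auto intro: exI[of _ "{}"])
      have "\<exists>\<F>. \<forall>w. finite (\<F> w) \<and> \<F> w \<subseteq> \<U> \<and> ?C w \<subseteq> \<Union> (\<F> w)"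
        by (intro choice allI covered)
      then obtain \<F> where \<F>: "\<forall>w. finite (\<F> w) \<and> \<F> w \<subseteq> \<U> \<and> ?C w \<subseteq> \<Union> (\<F> w)" by blast
      then have F: "finite (\<F> w)" "\<F> w \<subseteq> \<U>" "?C w \<subseteq> \<Union> (\<F> w)" for w by blast+
      have "prefix_cylinder x n \<subseteq> \<Union> (\<Union>w\<in>?Y. \<F> w)"
      proof
        fix y assume y: "y \<in> prefix_cylinder x n"
        then have "y \<in> \<Union> (\<F> (y (Suc n)))" using F(3)[of "y (Suc n)"] by blast
        moreover have "y (Suc n) \<in> ?Y" using y by (auto simp: prefix_cylinder_def)
        ultimately show "y \<in> \<Union> (\<Union>w\<in>?Y. \<F> w)" by blast
      qed
      moreover have "finite (\<Union>w\<in>?Y. \<F> w)" using finite_boundary_level F(1) by (rule finite_UN_I)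
      moreover have "(\<Union>w\<in>?Y. \<F> w) \<subseteq> \<U>" using F(2) by blast
      ultimately show False using x unfolding bad_def by blast
    qed
    obtain f where f: "\<And>n. f n \<in> boundary adj r \<and> bad (prefix_cylinder (f n) n)"
      and f_step: "\<And>n. f (Suc n) \<in> prefix_cylinder (f n) n"
      using dependent_nat_choice[of "\<lambda>n x. x \<in> boundary adj r \<and> bad (prefix_cylinder x n)"
          "\<lambda>n x y. y \<in> prefix_cylinder x n"] start step by blast
    define z where "z n = f n n" for n
    have agree: "f (n + k) i = f n i" if "i \<le> n" for n k i
      using that f_step by (induction k) (simp_all add: prefix_cylinder_def)
    have z_eq: "z i = f n i" if "i \<le> n" for i n
      using agree[of i i "n - i"] that by (simp add: z_def)
    have z: "z \<in> boundary adj r"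
      unfolding boundary_def
    proof (intro CollectI conjI allI)
      show "z 0 = r" using f[of 0] by (simp add: z_def boundary_def)
      show "adj (z n) (z (Suc n))" for n
        using f[of "Suc n"] z_eq[of n "Suc n"] z_eq[of "Suc n" "Suc n"] by (simp add: boundary_def)
      show "inj z"
      proof (rule injI)
        fix i j assume "z i = z j"
        then have "f (max i j) i = f (max i j) j" using z_eq[of i "max i j"] z_eq[of j "max i j"] by simp
        then show "i = j" using f[of "max i j"] by (auto simp: boundary_def inj_on_def)
      qed
    qed
    then obtain U where U: "U \<in> \<U>" "z \<in> U" using cov by blast
    obtain X where X: "finite X" "X \<subseteq> range z" "passing_through adj r X \<subseteq> U"
      using passing_through_base[OF op[OF U(1)] U(2)] by blast
    \<comment> \<open>Finitely many vertices of the path are all passed within an initial segment.\<close>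
    obtain I where I: "finite I" "X = z ` I" using X(1,2) by (meson finite_subset_image)
    define n where "n = Max (insert 0 I)"
    have n: "i \<le> n" if "i \<in> I" for i using that I(1) by (simp add: n_def)
    have "prefix_cylinder (f n) n \<subseteq> U"
    proof
      fix y assume y: "y \<in> prefix_cylinder (f n) n"
      have "z i = y i" if "i \<in> I" for i
        using y n[OF that] z_eq by (simp add: prefix_cylinder_def)
      then have "y \<in> passing_through adj r X"
        using y I(2) by (auto simp: passing_through_def prefix_cylinder_def)
      then show "y \<in> U" using X(3) by blast
    qed
    then have "\<not> bad (prefix_cylinder (f n) n)"
      unfolding bad_def not_not using U(1) by (intro exI[of _ "{U}"]) simp
    then show False using f by blast
  qed
  then show ?thesis unfolding compact_space_def compactin_def top by (simp add: Ball_def)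
qed

end

text \<open>
  All orbits of a permutation of \<open>Y\<close> have a length of at most \<open>card Y\<close>, which divides \<open>fact (card Y)\<close>.
  The point is that this exponent does not depend on the permutation.
\<close>

lemma funpow_fact_card_fixes:
  assumes Y: "finite Y" "g ` Y \<subseteq> Y" "inj_on g Y" and v: "v \<in> Y"
  shows "(g ^^ fact (card Y)) v = v"
proof -
  have in_Y: "(g ^^ n) y \<in> Y" if "y \<in> Y" for n y
    using that Y(2) by (induction n) auto
  have inj: "y = z" if "(g ^^ n) y = (g ^^ n) z" "y \<in> Y" "z \<in> Y" for n y z
    using that(1)
  proof (induction n)
    case (Suc n)
    then show ?case using inj_onD[OF Y(3)] in_Y that(2,3) by simp
  qed simp
  have "\<not> inj_on (\<lambda>n. (g ^^ n) v) {..card Y}"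
  proof
    assume "inj_on (\<lambda>n. (g ^^ n) v) {..card Y}"
    moreover have "(\<lambda>n. (g ^^ n) v) ` {..card Y} \<subseteq> Y" using in_Y v by blast
    ultimately have "card {..card Y} \<le> card Y" using card_inj_on_le Y(1) by blast
    then show False by simp
  qed
  then obtain i j where ij: "i < j" "j \<le> card Y" "(g ^^ i) v = (g ^^ j) v"
    unfolding inj_on_def by (metis atMost_iff linorder_neqE_nat)
  define d where "d = j - i"
  have d: "1 \<le> d" "d \<le> card Y" using ij by (simp_all add: d_def)
  have "(g ^^ i) ((g ^^ d) v) = (g ^^ (i + d)) v" by (simp add: funpow_add)
  also have "\<dots> = (g ^^ i) v" using ij by (simp add: d_def)
  finally have fix_d: "(g ^^ d) v = v" using inj in_Y v by blast
  have "d dvd fact (card Y)" using d by (rule dvd_fact)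
  then obtain m where m: "fact (card Y) = d * m" by (rule dvdE)
  have "((g ^^ d) ^^ m) v = v" using fix_d by (induction m) simp_all
  then show ?thesis unfolding m by (simp only: funpow_mult)
qed

context locally_finite_rooted_tree
begin

text \<open>
  The vertices at a given level are permuted by all automorphisms and are finite in number, so one
  exponent works for all group elements.  Taking powers in place of a finite-index subgroup suffices
  because the commutator argument only conjugates by powers.
\<close>

lemma invariant_neighbourhood:
  assumes H: "subgroup H (tree_aut V adj r)"
    and U: "openin (boundary_topology V adj r) U" and x: "x \<in> U"
  shows "\<exists>W k. openin (boundary_topology V adj r) W \<and> x \<in> W \<and> W \<subseteq> U \<and> 0 < k \<and>
    (\<forall>g\<in>H. (\<circ>) (g [^]\<^bsub>tree_aut V adj r\<lparr>carrier := H\<rparr>\<^esub> (k::nat)) ` W \<subseteq> W)"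
proof -
  let ?G = "tree_aut V adj r\<lparr>carrier := H\<rparr>"
  interpret T: group "tree_aut V adj r" by (rule group_tree_aut)
  interpret G: group ?G using H by (rule T.subgroup_imp_group)
  have sub: "g \<in> carrier (tree_aut V adj r)" if "g \<in> H" for g
    using subgroup.mem_carrier[OF H that] .
  have xb: "x \<in> boundary adj r"
    using openin_subset[OF U] x topspace_boundary_topology[OF root_in_V] by blast
  obtain X where X: "finite X" "X \<subseteq> range x" "passing_through adj r X \<subseteq> U"
    using passing_through_base[OF U x] by blast
  obtain I where I: "finite I" "X = x ` I" using X(1,2) by (meson finite_subset_image)
  define Y where "Y = (\<Union>i\<in>I. {y i |y. y \<in> boundary adj r})"
  have Y: "finite Y" using I(1) finite_boundary_level by (simp add: Y_def)
  have YV: "Y \<subseteq> V" using boundary_in_V by (auto simp: Y_def)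
  have XY: "X \<subseteq> Y" using I(2) xb by (auto simp: Y_def)
  let ?k = "fact (card Y) :: nat"
  have pow: "(g [^]\<^bsub>?G\<^esub> n) v = (g ^^ n) v" if "g \<in> H" "v \<in> V" for g v and n :: nat
    using that
  proof (induction n arbitrary: v)
    case 0
    then show ?case using tree_aut_one by simp
  next
    case (Suc n)
    then have "g [^]\<^bsub>?G\<^esub> n \<in> H" using G.nat_pow_closed[of g n] by simp
    then show ?case
      using Suc tree_aut_mult[OF sub sub, of "g [^]\<^bsub>?G\<^esub> n" g v] tree_aut_in_V[OF sub]
      by (simp add: funpow_swap1)
  qed
  have fixes_X: "(g [^]\<^bsub>?G\<^esub> ?k) v = v" if g: "g \<in> H" and v: "v \<in> X" for g v
  proof -
    have "g ` Y \<subseteq> Y"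
    proof
      fix w assume "w \<in> g ` Y"
      then obtain i y where "i \<in> I" "y \<in> boundary adj r" "w = (g \<circ> y) i" by (auto simp: Y_def)
      moreover from this have "g \<circ> y \<in> boundary adj r" using tree_aut_boundary[OF sub[OF g]] by blast
      ultimately show "w \<in> Y" unfolding Y_def by blast
    qed
    moreover have "inj_on g Y" using tree_aut_inj_on[OF sub[OF g]] YV by (rule inj_on_subset)
    ultimately have "(g ^^ ?k) v = v" using Y v XY by (intro funpow_fact_card_fixes) auto
    then show ?thesis using pow[OF g, of v] v XY YV by auto
  qed
  let ?W = "passing_through adj r X"
  have "(\<circ>) (g [^]\<^bsub>?G\<^esub> ?k) ` ?W \<subseteq> ?W" if g: "g \<in> H" for g
  proof
    fix z assume "z \<in> (\<circ>) (g [^]\<^bsub>?G\<^esub> ?k) ` ?W"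
    then obtain y where y: "y \<in> boundary adj r" "X \<subseteq> range y" "z = g [^]\<^bsub>?G\<^esub> ?k \<circ> y"
      by (auto simp: passing_through_def)
    have "g [^]\<^bsub>?G\<^esub> ?k \<in> H" using G.nat_pow_closed[of g ?k] g by simp
    then have "z \<in> boundary adj r" using tree_aut_boundary[OF sub y(1)] y(3) by blast
    moreover have "X \<subseteq> range z"
    proof
      fix v assume v: "v \<in> X"
      then obtain i where "v = y i" using y(2) by blast
      then have "z i = v" using fixes_X[OF g v] y(3) by simp
      then show "v \<in> range z" by blast
    qed
    ultimately show "z \<in> ?W" by (simp add: passing_through_def)
  qed
  moreover have "openin (boundary_topology V adj r) ?W"
    using root_in_V X(1) XY YV by (intro openin_passing_through) auto
  moreover have "x \<in> ?W" using xb X(2) by (simp add: passing_through_def)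
  ultimately show ?thesis using X(3) by (intro exI[of _ ?W] exI[of _ ?k]) auto
qed

end

section \<open>Free subgroups and the growth of germs\<close>

theorem theorem3p1:
  fixes V :: "'v set" and adj :: "'v \<Rightarrow> 'v \<Rightarrow> bool" and r :: 'v
    and H :: "('v \<Rightarrow> 'v) set" and S :: "(('v \<Rightarrow> 'v) \<times> (nat \<Rightarrow> 'v)) set set"
  defines "G \<equiv> (tree_aut V adj r)\<lparr>carrier := H\<rparr>"
    and "dT \<equiv> boundary_topology V adj r"
  assumes tree: "locally_finite_rooted_tree V adj r"
    and subgroup: "subgroup H (tree_aut V adj r)"
    and finitely_generated: "\<exists>A. finite A \<and> A \<subseteq> H \<and> generate (tree_aut V adj r) A = H"
    and faithful: "\<And>g. g \<in> H \<Longrightarrow> (\<forall>x\<in>boundary adj r. g \<circ> x = x) \<Longrightarrow> g = \<one>\<^bsub>G\<^esub>"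
    and generating: "open_compact_generating G dT (\<circ>) S"
    and growth: "\<And>x. x \<in> boundary adj r \<Longrightarrow> subexponential_growth (germ_growth G dT (\<circ>) S x)"
  shows "\<not> (\<exists>F. subgroup F G \<and> is_free_group (G\<lparr>carrier := F\<rparr>) \<and> \<not> comm_group (G\<lparr>carrier := F\<rparr>))"
proof
  assume "\<exists>F. subgroup F G \<and> is_free_group (G\<lparr>carrier := F\<rparr>) \<and> \<not> comm_group (G\<lparr>carrier := F\<rparr>)"
  then obtain F B where F: "subgroup F G" and free: "free_group_on (G\<lparr>carrier := F\<rparr>) B"
    and nonab: "\<not> comm_group (G\<lparr>carrier := F\<rparr>)"
    unfolding is_free_group_def by blast
  interpret locally_finite_rooted_tree V adj r by (rule tree)
  interpret T: group "tree_aut V adj r" by (rule group_tree_aut)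
  let ?K = "G\<lparr>carrier := F\<rparr>"
  have K: "?K = (tree_aut V adj r)\<lparr>carrier := F\<rparr>" by (simp add: G_def)
  have FT: "subgroup F (tree_aut V adj r)"
    using T.incl_subgroup[OF subgroup] F unfolding G_def by blast
  have FH: "F \<subseteq> H" using subgroup.subset[OF F] by (simp add: G_def)
  have top: "topspace dT = boundary adj r"
    unfolding dT_def using root_in_V by (rule topspace_boundary_topology)
  interpret G: topological_action G dT "(\<circ>)"
    unfolding G_def dT_def using subgroup by (rule topological_action_boundary)
  \<comment> \<open>The free germs are found for the action of \<open>F\<close> alone, the growth is measured in the groupoid of \<open>G\<close>.
      The two are compatible, since agreement near a point only depends on the maps.\<close>
  interpret K: topological_action ?K dT "(\<circ>)"
    unfolding K dT_def using FT by (rule topological_action_boundary)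
  have compact: "compact_space dT" unfolding dT_def by (rule compact_boundary)
  obtain a b where ab: "a \<in> B" "b \<in> B" "a \<noteq> b"
    using K.nonabelian_free_group_two_generators[OF free nonab] by blast
  have BF: "B \<subseteq> F" using free by (simp add: free_group_on_def)
  have "\<exists>x\<in>topspace dT. \<forall>g\<in>generate ?K {a, b}. \<forall>h\<in>generate ?K {a, b}. K.agree_near g h x \<longrightarrow> g = h"
  proof (rule K.free_group_exists_point_with_free_germs[OF compact _ _ free ab])
    show "g = \<one>\<^bsub>?K\<^esub>" if "g \<in> carrier ?K" "\<And>x. x \<in> topspace dT \<Longrightarrow> g \<circ> x = x" for g
      using faithful[of g] that FH top by auto
    show "\<exists>W k. openin dT W \<and> x \<in> W \<and> W \<subseteq> U \<and> 0 < (k::nat) \<and>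
        (\<forall>g\<in>carrier ?K. (\<circ>) (g [^]\<^bsub>?K\<^esub> k) ` W \<subseteq> W)" if "openin dT U" "x \<in> U" for x U
      using invariant_neighbourhood[OF FT that[unfolded dT_def]] unfolding K dT_def by simp
  qed
  then obtain x where x: "x \<in> topspace dT" and free_germs: "\<And>g h. g \<in> generate ?K {a, b} \<Longrightarrow>
      h \<in> generate ?K {a, b} \<Longrightarrow> K.agree_near g h x \<Longrightarrow> g = h" by blast
  have same_value: "word_value G (positive_word a b u) = word_value ?K (positive_word a b u)" for u
    by (induction u) (simp_all add: word_value_positive_Cons, simp add: positive_word_def)
  have in_generate: "word_value ?K (positive_word a b u) \<in> generate ?K {a, b}" for u
  proof (induction u)
    case Nil
    show ?case using generate.one[of ?K "{a, b}"] by (simp add: positive_word_def)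
  next
    case (Cons c u)
    have "(if c then a else b) \<in> generate ?K {a, b}" by (rule generate.incl) simp
    then show ?case unfolding word_value_positive_Cons using Cons by (rule generate.eng)
  qed
  have "\<exists>N>0. \<forall>n. 2 ^ n \<le> germ_growth G dT (\<circ>) S x (N * n)"
  proof (rule G.free_semigroup_germs_imp_exponential_growth[OF compact generating _ _ x])
    show "a \<in> carrier G" "b \<in> carrier G" using ab BF FH by (auto simp: G_def)
    fix u v
    assume "G.agree_near (word_value G (positive_word a b u)) (word_value G (positive_word a b v)) x"
    then have "word_value ?K (positive_word a b u) = word_value ?K (positive_word a b v)"
      unfolding same_value by (rule free_germs[OF in_generate in_generate])
    moreover have "positive_word a b w \<in> reduced_words B" for w
      using ab by (auto simp: reduced_words_def positive_word_def successively_map successively_conv_nth)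
    ultimately have "positive_word a b u = positive_word a b v"
      using free unfolding free_group_on_def bij_betw_def inj_on_def by blast
    moreover have "inj (\<lambda>c. (if c then a else b, True))" using ab(3) by (auto simp: inj_on_def)
    ultimately show "u = v" unfolding positive_word_def by (simp add: inj_map_eq_map)
  qed
  then show False using not_subexponential_if_power_bound growth x top by metis
qed

end
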